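(* Let $\psi:[1,\infty)\to[0,\infty)$ be a strictly increasing and convex homeomorphism, let $I>0$, and write $g(x)=\log(\psi(x))$. Assume that $$\int_{\psi^{-1}(e^2)}^\infty\frac{\log\log\psi(x)}{x^2}\,dx<\infty.$$ For $0<r<R\le 1$ let $\Gamma$ be the family of curves in the annulus $A=\{z\in\mathbb{C}: r<|z|<R\}$ joining its inner and outer boundary. Then $$2\pi\bigl(M_{\psi,I}(\Gamma)\bigr)^{-1}=o_{\psi,I}(1)+\frac12\int_{g^{-1}(2\log(R^{-1}))}^{g^{-1}(2\log(r^{-1}))}\frac{g'(x)\,dx}{x}$$ (where $g'(x)\,dx$ is understood as $dg(x)$ if $\psi$ is not differentiable), and for fixed $I$ and $\psi$ the error term satisfies $o_{\psi,I}(1)\to 0$ as $R\to 0$ (uniformly in $r\in(0,R)$).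
   Context: Weighted modulus: for a path family $\Gamma$, a Borel function $\rho:\mathbb{C}\to[0,\infty]$ is admissible if $\int_\gamma\rho\,|dz|\ge 1$ for every locally rectifiable $\gamma\in\Gamma$; for a measurable weight $\omega\ge 0$ set $M_\omega(\Gamma)=\inf_{\rho\text{ admissible}}\int\rho^2\omega\,dA$. Conditional modulus: for the family $\Gamma$ of curves joining the boundary components of the annulus $A$ inside $A$, $M_{\psi,I}(\Gamma)$ is the supremum of $M_K(\Gamma)$ over all measurable functions $K\ge 1$ on $A$ satisfying $\int_A\psi(K)\,dA\le I$. *)

theory Defs
  imports "HOL-Analysis.Analysis"
begin

text \<open>
  The Lebesgue--Stieltjes measure \<open>dF\<close> of a monotone continuous function \<open>F\<close> on \<open>[a, b]\<close>.
  Since \<^const>\<open>interval_measure\<close> needs a function that is monotone on the whole line,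
  \<open>F\<close> is extended by constants outside \<open>[a, b]\<close>; the values of \<open>F\<close> there are irrelevant.
\<close>

definition stieltjes_measure :: "(real \<Rightarrow> real) \<Rightarrow> real \<Rightarrow> real \<Rightarrow> real measure" where
  "stieltjes_measure F a b = interval_measure (\<lambda>x. F (max a (min b x)))"

definition stieltjes_integral :: "real \<Rightarrow> real \<Rightarrow> (real \<Rightarrow> real) \<Rightarrow> (real \<Rightarrow> real) \<Rightarrow> real" where
  "stieltjes_integral a b h F = (LINT x:{a..b}|stieltjes_measure F a b. h x)"

definition arc_length :: "(real \<Rightarrow> complex) \<Rightarrow> real \<Rightarrow> real \<Rightarrow> ennreal" where
  "arc_length \<gamma> a b =
     Sup {\<Sum>i<n. ennreal (dist (\<gamma> (t i)) (\<gamma> (t (Suc i)))) | n t.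
            mono_on {..n} t \<and> t 0 = a \<and> t n = b}"

text \<open>
  Curves are parametrized by the open interval \<open>(0, 1)\<close>; values of \<open>\<gamma>\<close> outside of it are
  irrelevant.  Such a curve need not have end points and may have infinite total length.
\<close>

definition locally_rectifiable :: "(real \<Rightarrow> complex) \<Rightarrow> bool" where
  "locally_rectifiable \<gamma> \<longleftrightarrow> (\<forall>a b. 0 < a \<and> a \<le> b \<and> b < 1 \<longrightarrow> arc_length \<gamma> a b < \<infinity>)"

text \<open>
  The integral \<open>\<integral>\<^sub>\<gamma> \<rho> |dz|\<close> along a locally rectifiable curve: the supremum over compact
  subcurves of the Stieltjes integral of \<open>\<rho> \<circ> \<gamma>\<close> with respect to the length function.
\<close>

definition curve_integral :: "(complex \<Rightarrow> ennreal) \<Rightarrow> (real \<Rightarrow> complex) \<Rightarrow> ennreal" where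
  "curve_integral \<rho> \<gamma> =
     Sup {\<integral>\<^sup>+t\<in>{a..b}. \<rho> (\<gamma> t) \<partial>stieltjes_measure (\<lambda>s. enn2real (arc_length \<gamma> a s)) a b | a b.
            0 < a \<and> a \<le> b \<and> b < 1}"

definition admissible :: "(complex \<Rightarrow> ennreal) \<Rightarrow> (real \<Rightarrow> complex) set \<Rightarrow> bool" where
  "admissible \<rho> \<Gamma> \<longleftrightarrow>
     \<rho> \<in> borel_measurable borel \<and>
     (\<forall>\<gamma>\<in>\<Gamma>. locally_rectifiable \<gamma> \<longrightarrow> curve_integral \<rho> \<gamma> \<ge> 1)"

definition weighted_modulus :: "(complex \<Rightarrow> ennreal) \<Rightarrow> (real \<Rightarrow> complex) set \<Rightarrow> ennreal" where
  "weighted_modulus \<omega> \<Gamma> = (INF \<rho>\<in>{\<rho>. admissible \<rho> \<Gamma>}. \<integral>\<^sup>+z. (\<rho> z)\<^sup>2 * \<omega> z \<partial>lebesgue)"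

definition annulus :: "real \<Rightarrow> real \<Rightarrow> complex set" where
  "annulus r R = {z. r < cmod z \<and> cmod z < R}"

definition joining_curves :: "real \<Rightarrow> real \<Rightarrow> (real \<Rightarrow> complex) set" where
  "joining_curves r R =
     {\<gamma>. continuous_on {0<..<1} \<gamma> \<and> \<gamma> ` {0<..<1} \<subseteq> annulus r R \<and>
         ((\<lambda>t. cmod (\<gamma> t)) \<longlongrightarrow> r) (at_right 0) \<and> ((\<lambda>t. cmod (\<gamma> t)) \<longlongrightarrow> R) (at_left 1)}"

text \<open>A function \<open>K\<close> on \<open>A\<close> acts as a weight on the plane through its extension by zero.\<close>

definition conditional_modulus ::
  "(real \<Rightarrow> real) \<Rightarrow> real \<Rightarrow> complex set \<Rightarrow> (real \<Rightarrow> complex) set \<Rightarrow> ennreal" where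
  "conditional_modulus \<psi> I A \<Gamma> =
     (SUP K\<in>{K :: complex \<Rightarrow> real.
               K \<in> borel_measurable (lebesgue_on A) \<and> (\<forall>z\<in>A. 1 \<le> K z) \<and>
               (\<integral>\<^sup>+z\<in>A. ennreal (\<psi> (K z)) \<partial>lebesgue) \<le> ennreal I}.
        weighted_modulus (\<lambda>z. ennreal (K z) * indicator A z) \<Gamma>)"

end

theory Submission
  imports Defs
begin

text \<open>
  Let \<open>\<phi>\<close> be the inverse of \<open>\<psi>\<close> and \<open>k0 s = \<phi> (1 / s\<^sup>2)\<close>.  The substitution \<open>g x = 2 * ln (1 / s)\<close> turns half
  the Stieltjes integral into \<open>J = \<integral>\<^sub>r\<^sup>R ds / (s * k0 s)\<close>.

  Upper bound for the modulus: by convexity \<open>K \<le> k0 s + k0 s * s\<^sup>2 * \<psi> K\<close> for every \<open>K \<ge> 1\<close>.  Testing any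
  feasible weight with the radial metric \<open>1 / (\<bar>z\<bar> * k0 \<bar>z\<bar> * J)\<close> therefore gives
  \<open>M \<le> (2 * pi * J + I / k0 R) / J\<^sup>2\<close>, and \<open>k0 R\<close> tends to infinity as \<open>R\<close> tends to \<open>0\<close>.

  Lower bound: for a radial weight \<open>k\<close>, restricting to radial segments yields \<open>2 * pi / M \<le> \<integral> ds / (s * k s)\<close>.
  For small \<open>R\<close> the weight given by \<open>\<psi> (k1 s) = 1 / (s * ln s)\<^sup>2\<close> is feasible.  Writing
  \<open>1 / k1 - 1 / k0 = \<integral> dx / x\<^sup>2\<close> over \<open>[k1, k0]\<close> and exchanging the integrals, one sees that replacing \<open>k0\<close> by
  \<open>k1\<close> costs at most a tail of \<open>\<integral> ln (ln (\<psi> x)) / x\<^sup>2 dx\<close>.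
\<close>

section \<open>Polar coordinates\<close>

text \<open>The exponent in \<open>1 / s^2\<close> reflects scale invariance: area in polar form is
  \<open>2 * pi * s ds\<close>, so \<open>\<psi> (k0 \<bar>z\<bar>) = 1 / \<bar>z\<bar>^2\<close>
  puts the same mass on similar annuli, in total \<open>2 * pi * ln (R / r)\<close>. This exceeds
  any budget \<open>I\<close> as \<open>r\<close> shrinks, so \<open>k0\<close> itself cannot be the
  competitor. The factor \<open>1 / (ln s)^2\<close> restores integrability, and its trace on the
  scale of \<open>ln \<psi>\<close> is the iterated logarithm of the hypothesis. Both error terms
  have to be absolute, since \<open>J\<close> is arbitrarily small when \<open>r\<close> is close to
  \<open>R\<close>. The upper bound for the modulus gives
  \<open>2 * pi / M >= J - I / (2 * pi * k0 R)\<close>, the lower one gives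
  \<open>2 * pi / M <= J +\<close> a tail beginning at \<open>\<phi> (1 / R)\<close>. Neither error
  depends on \<open>r\<close>, which is the source of the uniformity. The analytic obstacle is the
  admissibility of the radial metric: it must be tested on every locally rectifiable curve, through
  the Stieltjes measure of its length function. Partitions and right-continuity of that function
  replace a reparametrization by arc length.\<close>

lemma distr_Complex_lborel:
  "distr (lborel \<Otimes>\<^sub>M lborel) borel (\<lambda>(x, y). Complex x y) = lborel"
proof (rule lborel_eqI[symmetric])
  have m[measurable]: "(\<lambda>(x, y). Complex x y) \<in> borel_measurable (lborel \<Otimes>\<^sub>M lborel)"
    by (auto simp: Complex_eq split_beta intro!: borel_measurable_add borel_measurable_times)
  fix l u :: complex
  assume "\<And>b. b \<in> Basis \<Longrightarrow> l \<bullet> b \<le> u \<bullet> b"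
  from this[of 1] this[of \<i>] have le: "Re l \<le> Re u" "Im l \<le> Im u"
    by (auto simp: Basis_complex_def)
  have "(\<lambda>(x, y). Complex x y) -` box l u = box (Re l) (Re u) \<times> box (Im l) (Im u)"
    by (auto simp: in_box_complex_iff)
  then show "emeasure (distr (lborel \<Otimes>\<^sub>M lborel) borel (\<lambda>(x, y). Complex x y)) (box l u) =
      (\<Prod>b\<in>Basis. (u - l) \<bullet> b)"
    using le by (simp add: emeasure_distr space_pair_measure lborel.emeasure_pair_measure_Times
        Basis_complex_def ennreal_mult)
qed simp

lemma nn_integral_complex:
  fixes f :: "complex \<Rightarrow> ennreal"
  assumes [measurable]: "f \<in> borel_measurable borel"
  shows "(\<integral>\<^sup>+z. f z \<partial>lborel) = (\<integral>\<^sup>+x. \<integral>\<^sup>+y. f (Complex x y) \<partial>lborel \<partial>lborel)"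
proof -
  have m[measurable]: "(\<lambda>(x, y). Complex x y) \<in> borel_measurable (lborel \<Otimes>\<^sub>M lborel)"
    by (auto simp: Complex_eq split_beta intro!: borel_measurable_add borel_measurable_times)
  show ?thesis
    by (subst distr_Complex_lborel[symmetric])
      (simp add: nn_integral_distr lborel_pair.nn_integral_snd split_beta
        flip: lborel.nn_integral_fst)
qed

lemma Complex_measurable[measurable (raw)]:
  assumes [measurable]: "f \<in> borel_measurable M" "g \<in> borel_measurable M"
  shows "(\<lambda>x. Complex (f x) (g x)) \<in> borel_measurable M"
  by (simp add: Complex_eq)

text \<open>Multiplication by \<open>\<i>\<close> is a swap of coordinates combined with one
  reflection, so Tonelli and \<open>y -> -y\<close> suffice. These quarter turns carry the sector
  below around the plane.\<close>

lemma nn_integral_times_ii: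
  fixes f :: "complex \<Rightarrow> ennreal"
  assumes [measurable]: "f \<in> borel_measurable borel"
  shows "(\<integral>\<^sup>+z. f (\<i> * z) \<partial>lborel) = (\<integral>\<^sup>+z. f z \<partial>lborel)"
proof -
  have "(\<integral>\<^sup>+z. f (\<i> * z) \<partial>lborel) = (\<integral>\<^sup>+x. \<integral>\<^sup>+y. f (Complex (- y) x) \<partial>lborel \<partial>lborel)"
    by (subst nn_integral_complex) (auto simp: complex_eq_iff intro!: nn_integral_cong arg_cong[where f=f])
  also have "\<dots> = (\<integral>\<^sup>+x. \<integral>\<^sup>+y. f (Complex y x) \<partial>lborel \<partial>lborel)"
    using nn_integral_real_affine[of "\<lambda>y. f (Complex y x)" "-1" 0 for x] by simp
  also have "\<dots> = (\<integral>\<^sup>+y. \<integral>\<^sup>+x. f (Complex y x) \<partial>lborel \<partial>lborel)"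
    by (rule lborel_pair.Fubini') simp
  also have "\<dots> = (\<integral>\<^sup>+z. f z \<partial>lborel)"
    by (rule nn_integral_complex[symmetric]) simp
  finally show ?thesis .
qed

lemma cos_pos_quarter: "x \<in> {-pi/4..pi/4} \<Longrightarrow> 0 < cos x"
  using pi_gt_zero by (intro cos_gt_zero_pi) (auto simp del: pi_gt_zero)

text \<open>
  In the sector \<open>\<bar>Im z\<bar> < Re z\<close> the substitutions \<open>y = x * tan \<theta>\<close> and \<open>x = s * cos \<theta>\<close> only involve the
  compact range \<open>\<bar>\<theta>\<bar> \<le> pi / 4\<close>; four rotated copies of the sector fill the plane.
\<close>
lemma nn_integral_sector:
  fixes f :: "complex \<Rightarrow> ennreal"
  assumes [measurable]: "f \<in> borel_measurable borel"
  shows "(\<integral>\<^sup>+z. f z * indicator {z. \<bar>Im z\<bar> < Re z} z \<partial>lborel) =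
    (\<integral>\<^sup>+\<theta>\<in>{-pi/4..pi/4}. \<integral>\<^sup>+s\<in>{0<..}. f (of_real s * cis \<theta>) * ennreal s \<partial>lborel \<partial>lborel)"
proof -
  have [measurable]: "{z. \<bar>Im z\<bar> < Re z} \<in> sets borel"
    by (intro borel_open open_Collect_less continuous_intros)
  have tan_inner: "(\<integral>\<^sup>+y. f (Complex x y) * indicator {z. \<bar>Im z\<bar> < Re z} (Complex x y) \<partial>lborel) =
    (\<integral>\<^sup>+\<theta>\<in>{-pi/4..pi/4}. f (Complex x (x * tan \<theta>)) * ennreal (x * inverse ((cos \<theta>)\<^sup>2)) * indicator {0<..} x \<partial>lborel)"
    (is "?L = ?R") for x
  proof (cases "0 < x")
    case True
    have "?L = (\<integral>\<^sup>+y. f (Complex x y) * indicator {x * tan (-pi/4)..x * tan (pi/4)} y \<partial>lborel)"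
    proof (rule nn_integral_cong_AE)
      \<comment> \<open>The open sector condition and the closed interval differ at most at
        \<open>y = x\<close> and \<open>y = -x\<close>.\<close>
      show "AE y in lborel. f (Complex x y) * indicator {z. \<bar>Im z\<bar> < Re z} (Complex x y) =
        f (Complex x y) * indicator {x * tan (-pi/4)..x * tan (pi/4)} y"
        using AE_lborel_singleton[of x] AE_lborel_singleton[of "-x"]
        by eventually_elim (auto simp: tan_45 split: split_indicator)
    qed
    also have "\<dots> = (\<integral>\<^sup>+\<theta>. f (Complex x (x * tan \<theta>)) * ennreal (x * inverse ((cos \<theta>)\<^sup>2)) * indicator {-pi/4..pi/4} \<theta> \<partial>lborel)"
    proof (rule nn_integral_substitution_aux)
      fix t assume t: "t \<in> {-pi/4..pi/4}"
      have "cos t > 0" using cos_pos_quarter[OF t] .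
      then show "((\<lambda>t. x * tan t) has_real_derivative x * inverse ((cos t)\<^sup>2)) (at t)"
        by (intro DERIV_cmult DERIV_tan) auto
      show "0 \<le> x * inverse ((cos t)\<^sup>2)" using True by auto
    next
      show "continuous_on {-pi/4..pi/4} (\<lambda>t. x * inverse ((cos t)\<^sup>2))"
        using cos_pos_quarter by (intro continuous_intros) force
    qed (auto intro: pi_gt_zero)
    finally show ?thesis using True by (simp add: mult.assoc)
  qed (auto split: split_indicator)
  have "(\<integral>\<^sup>+z. f z * indicator {z. \<bar>Im z\<bar> < Re z} z \<partial>lborel) =
    (\<integral>\<^sup>+x. \<integral>\<^sup>+y. f (Complex x y) * indicator {z. \<bar>Im z\<bar> < Re z} (Complex x y) \<partial>lborel \<partial>lborel)"
    by (rule nn_integral_complex) simp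
  also have "\<dots> = (\<integral>\<^sup>+x. (\<integral>\<^sup>+\<theta>\<in>{-pi/4..pi/4}. f (Complex x (x * tan \<theta>)) * ennreal (x * inverse ((cos \<theta>)\<^sup>2)) * indicator {0<..} x \<partial>lborel) \<partial>lborel)"
    by (simp only: tan_inner)
  also have "\<dots> = (\<integral>\<^sup>+\<theta>. \<integral>\<^sup>+x. f (Complex x (x * tan \<theta>)) * ennreal (x * inverse ((cos \<theta>)\<^sup>2)) * indicator {0<..} x * indicator {-pi/4..pi/4} \<theta> \<partial>lborel \<partial>lborel)"
    by (rule lborel_pair.Fubini') (simp add: split_beta tan_def)
  also have "\<dots> = (\<integral>\<^sup>+\<theta>\<in>{-pi/4..pi/4}. \<integral>\<^sup>+s\<in>{0<..}. f (of_real s * cis \<theta>) * ennreal s \<partial>lborel \<partial>lborel)"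
  proof (rule nn_integral_cong)
    fix t
    show "(\<integral>\<^sup>+x. f (Complex x (x * tan t)) * ennreal (x * inverse ((cos t)\<^sup>2)) * indicator {0<..} x * indicator {-pi/4..pi/4} t \<partial>lborel) =
      (\<integral>\<^sup>+s\<in>{0<..}. f (of_real s * cis t) * ennreal s \<partial>lborel) * indicator {-pi/4..pi/4} t"
    proof (cases "t \<in> {-pi/4..pi/4}")
      case True
      have c: "cos t > 0" using cos_pos_quarter[OF True] .
      have "(\<integral>\<^sup>+x. f (Complex x (x * tan t)) * ennreal (x * inverse ((cos t)\<^sup>2)) * indicator {0<..} x \<partial>lborel)
        = ennreal \<bar>cos t\<bar> * (\<integral>\<^sup>+s. f (Complex (0 + cos t * s) ((0 + cos t * s) * tan t)) * ennreal ((0 + cos t * s) * inverse ((cos t)\<^sup>2)) * indicator {0<..} (0 + cos t * s) \<partial>lborel)"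
        by (rule nn_integral_real_affine) (use c in auto)
      also have "\<dots> = (\<integral>\<^sup>+s. ennreal \<bar>cos t\<bar> * (f (Complex (0 + cos t * s) ((0 + cos t * s) * tan t)) * ennreal ((0 + cos t * s) * inverse ((cos t)\<^sup>2)) * indicator {0<..} (0 + cos t * s)) \<partial>lborel)"
        by (rule nn_integral_cmult[symmetric]) simp
      also have "\<dots> = (\<integral>\<^sup>+s\<in>{0<..}. f (of_real s * cis t) * ennreal s \<partial>lborel)"
      proof (rule nn_integral_cong)
        fix s :: real
        have "Complex (cos t * s) (cos t * s * tan t) = of_real s * cis t"
          using c by (auto simp: complex_eq_iff tan_def)
        \<comment> \<open>The Jacobian \<open>x / (cos t)^2\<close> of the tangent substitution and
          the factor \<open>cos t\<close> of the scaling \<open>x = s * cos t\<close> multiply to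
          the polar density \<open>s\<close>.\<close>
        moreover have "ennreal (cos t) * ennreal (cos t * s * inverse ((cos t)\<^sup>2)) = ennreal s" if "s > 0"
          using c that by (subst ennreal_mult[symmetric]) (auto simp: power2_eq_square field_simps)
        ultimately show "ennreal \<bar>cos t\<bar> * (f (Complex (0 + cos t * s) ((0 + cos t * s) * tan t)) * ennreal ((0 + cos t * s) * inverse ((cos t)\<^sup>2)) * indicator {0<..} (0 + cos t * s))
         = f (of_real s * cis t) * ennreal s * indicator {0<..} s"
          using c by (cases "s > 0") (simp_all add: zero_less_mult_iff mult.left_commute[of "ennreal (cos t)"])
      qed
      finally show ?thesis using True by simp
    qed simp
  qed
  finally show ?thesis .
qed

lemma nn_integral_polar:
  fixes f :: "complex \<Rightarrow> ennreal"
  assumes [measurable]: "f \<in> borel_measurable borel"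
  shows "(\<integral>\<^sup>+z. f z \<partial>lborel) =
    (\<Sum>k<4. \<integral>\<^sup>+\<theta>\<in>{-pi/4..pi/4}. \<integral>\<^sup>+s\<in>{0<..}. f (\<i> ^ k * (of_real s * cis \<theta>)) * ennreal s \<partial>lborel \<partial>lborel)"
proof -
  define S where "S = {z. \<bar>Im z\<bar> < Re z}"
  have [measurable]: "S \<in> sets borel"
    unfolding S_def by (intro borel_open open_Collect_less continuous_intros)
  have null: "AE z in lborel. a \<bullet> z \<noteq> (0::real)" if "a \<noteq> 0" for a :: complex
  proof -
    have "{z. a \<bullet> z = 0} \<in> null_sets lebesgue"
      using negligible_hyperplane[of a 0] that by (simp add: negligible_iff_null_sets)
    then have "AE z in lebesgue. a \<bullet> z \<noteq> 0"
      by (auto dest!: AE_not_in elim!: eventually_mono)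
    then show ?thesis
      by (simp add: AE_completion_iff)
  qed
  \<comment> \<open>Off the two diagonals exactly one of the four quarter turns of \<open>z\<close>
    lies in \<open>S\<close>. The exponent \<open>4 - k\<close> expresses the inverse of
    \<open>\<i> ^ k\<close> by a natural power.\<close>
  have "AE z in lborel. Complex 1 1 \<bullet> z \<noteq> 0 \<and> Complex 1 (-1) \<bullet> z \<noteq> 0"
    using null[of "Complex 1 1"] null[of "Complex 1 (-1)"] by (auto simp: complex_eq_iff)
  then have "AE z in lborel. f z = (\<Sum>k<4. f z * indicator S (\<i> ^ (4 - k) * z))"
  proof eventually_elim
    case (elim z)
    have "(\<Sum>k<4. indicator S (\<i> ^ (4 - k) * z)) = (1::ennreal)"
      using elim by (auto simp: S_def numeral_eq_Suc indicator_def inner_complex_def)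
    then show ?case by (simp flip: sum_distrib_left)
  qed
  then have "(\<integral>\<^sup>+z. f z \<partial>lborel) = (\<integral>\<^sup>+z. (\<Sum>k<4. f z * indicator S (\<i> ^ (4 - k) * z)) \<partial>lborel)"
    by (rule nn_integral_cong_AE)
  also have "\<dots> = (\<Sum>k<4. \<integral>\<^sup>+z. f z * indicator S (\<i> ^ (4 - k) * z) \<partial>lborel)"
    by (rule nn_integral_sum) simp
  also have "\<dots> = (\<Sum>k<4. \<integral>\<^sup>+z. f (\<i> ^ k * z) * indicator S z \<partial>lborel)"
  proof (rule sum.cong[OF refl])
    fix k :: nat assume k: "k \<in> {..<4}"
    have rot: "(\<integral>\<^sup>+z. h (\<i> ^ k * z) \<partial>lborel) = (\<integral>\<^sup>+z. h z \<partial>lborel)"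
      if [measurable]: "h \<in> borel_measurable borel" for h :: "complex \<Rightarrow> ennreal"
    proof (induction k)
      case (Suc k)
      then show ?case
        using nn_integral_times_ii[of "\<lambda>z. h (\<i> ^ k * z)"] by (simp add: ac_simps)
    qed simp
    have "\<i> ^ (4 - k) * \<i> ^ k = 1"
      using k by (simp flip: power_add)
    then have i4: "\<i> ^ (4 - k) * (\<i> ^ k * z) = z" for z
      by (simp flip: mult.assoc)
    have "(\<integral>\<^sup>+z. f z * indicator S (\<i> ^ (4 - k) * z) \<partial>lborel) =
       (\<integral>\<^sup>+z. f (\<i> ^ k * z) * indicator S (\<i> ^ (4 - k) * (\<i> ^ k * z)) \<partial>lborel)"
      by (rule rot[symmetric]) simp
    then show "(\<integral>\<^sup>+z. f z * indicator S (\<i> ^ (4 - k) * z) \<partial>lborel) = (\<integral>\<^sup>+z. f (\<i> ^ k * z) * indicator S z \<partial>lborel)"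
      by (simp only: i4)
  qed
  also have "\<dots> = (\<Sum>k<4. \<integral>\<^sup>+\<theta>\<in>{-pi/4..pi/4}. \<integral>\<^sup>+s\<in>{0<..}. f (\<i> ^ k * (of_real s * cis \<theta>)) * ennreal s \<partial>lborel \<partial>lborel)"
    unfolding S_def by (intro sum.cong refl nn_integral_sector) simp
  finally show ?thesis .
qed

lemma nn_integral_radial:
  fixes f :: "real \<Rightarrow> ennreal"
  assumes [measurable]: "f \<in> borel_measurable borel"
  shows "(\<integral>\<^sup>+z. f (cmod z) \<partial>lborel) = ennreal (2 * pi) * (\<integral>\<^sup>+s\<in>{0<..}. f s * ennreal s \<partial>lborel)"
proof -
  have e: "4 * ennreal (pi / 2) = ennreal (2 * pi)"
    by (simp flip: ennreal_numeral ennreal_mult'')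
  have inner: "(\<integral>\<^sup>+s\<in>{0<..}. f (cmod (\<i> ^ k * (of_real s * cis \<theta>))) * ennreal s \<partial>lborel) =
      (\<integral>\<^sup>+s\<in>{0<..}. f s * ennreal s \<partial>lborel)" for k \<theta>
    by (intro nn_integral_cong) (auto simp: norm_mult norm_power split: split_indicator)
  have "(\<integral>\<^sup>+z. f (cmod z) \<partial>lborel) =
    (\<Sum>k<(4::nat). \<integral>\<^sup>+\<theta>\<in>{-pi/4..pi/4}. \<integral>\<^sup>+s\<in>{0<..}. f s * ennreal s \<partial>lborel \<partial>lborel)"
    by (simp add: nn_integral_polar inner)
  also have "\<dots> = ennreal (2 * pi) * (\<integral>\<^sup>+s\<in>{0<..}. f s * ennreal s \<partial>lborel)"
    using e by (simp add: nn_integral_cmult) (metis mult.assoc mult.commute)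
  finally show ?thesis .
qed

section \<open>Lebesgue-Stieltjes measures\<close>

text \<open>Outside \<open>[a, b)\<close> the clamped function is constant to the right of each
  point, so right-continuity inside is enough. In this form the lemma applies to arc length
  functions, for which right-continuity is what is proved below.\<close>

lemma emeasure_stieltjes_Ioc:
  assumes "a \<le> b" "mono_on {a..b} F"
    and cont: "\<And>x. a \<le> x \<Longrightarrow> x < b \<Longrightarrow> (F \<longlongrightarrow> F x) (at_right x)"
    and "c \<le> d"
  shows "emeasure (stieltjes_measure F a b) {c<..d} =
    ennreal (F (max a (min b d)) - F (max a (min b c)))"
  unfolding stieltjes_measure_def
proof (rule emeasure_interval_measure_Ioc[OF \<open>c \<le> d\<close>])
  show "F (max a (min b x)) \<le> F (max a (min b y))" if "x \<le> y" for x y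
    using that assms(1) by (intro mono_onD[OF assms(2)]) auto
  fix p :: real
  have "((\<lambda>x. F (max a (min b x))) \<longlongrightarrow> F (max a (min b p))) (at_right p)"
  proof (cases "a \<le> p \<and> p < b")
    case True
    then have "\<forall>\<^sub>F x in at_right p. F x = F (max a (min b x))"
      unfolding eventually_at_right_field by (intro exI[of _ b]) auto
    from Lim_transform_eventually[OF cont this] show ?thesis using True by auto
  next
    case False
    have "\<exists>q>p. \<forall>x. p < x \<and> x < q \<longrightarrow> F (max a (min b p)) = F (max a (min b x))"
    proof (cases "p < a")
      case True
      then show ?thesis using \<open>a \<le> b\<close> by (intro exI[of _ a]) (auto simp: max_def min_def)
    next
      case False
      with \<open>\<not> (a \<le> p \<and> p < b)\<close> show ?thesis
        using \<open>a \<le> b\<close> by (intro exI[of _ "p + 1"]) (auto simp: max_def min_def)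
    qed
    then have "\<forall>\<^sub>F x in at_right p. F (max a (min b p)) = F (max a (min b x))"
      unfolding eventually_at_right_field by auto
    from Lim_transform_eventually[OF tendsto_const this] show ?thesis .
  qed
  then show "continuous (at_right p) (\<lambda>x. F (max a (min b x)))"
    by (simp add: continuous_within)
qed

lemma sets_stieltjes_measure[simp, measurable_cong]: "sets (stieltjes_measure F a b) = sets borel"
  and space_stieltjes_measure[simp]: "space (stieltjes_measure F a b) = UNIV"
  by (simp_all add: stieltjes_measure_def)

lemma continuous_on_clamp:
  assumes "continuous_on {u..v} G" "u \<le> (v::real)"
  shows "continuous_on UNIV (\<lambda>x. G (max u (min v x)))"
  by (rule continuous_on_compose2[OF assms(1)]) (use assms(2) in \<open>auto intro!: continuous_intros\<close>)

text \<open>Both measures give a half-open interval the increment of the clamped \<open>F\<close>,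
  and such intervals generate the Borel sets. \<open>G\<close> is clamped as well, to be continuous
  and hence measurable on the whole line.\<close>

lemma stieltjes_measure_eq_distr:
  fixes F G :: "real \<Rightarrow> real"
  assumes ab: "a \<le> b" and mono: "mono_on {a..b} F"
    and F: "continuous_on {a..b} F" and G: "continuous_on {F a..F b} G"
    and GF: "\<And>x. x \<in> {a..b} \<Longrightarrow> G (F x) = x"
    and FG: "\<And>u. u \<in> {F a..F b} \<Longrightarrow> G u \<in> {a..b} \<and> F (G u) = u"
  shows "stieltjes_measure F a b =
    distr (density lborel (indicator {F a..F b})) borel (\<lambda>u. G (max (F a) (min (F b) u)))"
    (is "?M = distr ?N borel ?G")
proof (rule measure_eqI_generator_eq)
  let ?E = "range (\<lambda>(c, d). {c<..d::real})"
  have Fab: "F a \<le> F b" using mono ab by (auto dest: mono_onD)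
  have [measurable]: "?G \<in> borel_measurable borel"
    by (intro borel_measurable_continuous_onI continuous_on_clamp G Fab)
  have cont: "(F \<longlongrightarrow> F x) (at_right x)" if "a \<le> x" "x < b" for x
    using continuous_on_Icc_at_rightD[of x b F] continuous_on_subset[OF F, of "{x..b}"] that by auto
  show "Int_stable ?E"
  proof (rule Int_stableI_image)
    fix p q :: "real \<times> real"
    have "{fst p<..snd p} \<inter> {fst q<..snd q} = {max (fst p) (fst q)<..min (snd p) (snd q)}"
      by auto
    then show "\<exists>k\<in>UNIV. (case p of (c, d) \<Rightarrow> {c<..d}) \<inter> (case q of (c, d) \<Rightarrow> {c<..d}) = (case k of (c, d) \<Rightarrow> {c<..d})"
      by (intro bexI[of _ "(max (fst p) (fst q), min (snd p) (snd q))"]) (auto simp: split_beta)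
  qed
  show "sets ?M = sigma_sets UNIV ?E" "sets (distr ?N borel ?G) = sigma_sets UNIV ?E"
    by (simp_all add: borel_sigma_sets_Ioc)
  define A where "A = (\<lambda>n. {- real n<..real n})"
  show "range A \<subseteq> ?E" by (auto simp: A_def)
  show "(\<Union>i. A i) = UNIV"
  proof -
    have "\<exists>n. x \<in> A n" for x :: real
    proof -
      obtain n where "\<bar>x\<bar> < real n" using reals_Archimedean2 by blast
      then show ?thesis unfolding A_def by (intro exI[of _ n]) auto
    qed
    then show ?thesis by blast
  qed
  show "emeasure ?M (A i) \<noteq> \<infinity>" for i
    unfolding A_def by (subst emeasure_stieltjes_Ioc[OF ab mono cont]) auto
  fix X assume "X \<in> ?E"
  then obtain c d where X: "X = {c<..d}" by auto
  show "emeasure ?M X = emeasure (distr ?N borel ?G) X"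
  proof (cases "c \<le> d")
    case True
    let ?k = "\<lambda>x. max a (min b x)"
    define T where "T = ?G -` {c<..d} \<inter> {F a..F b}"
    have vs: "h -` {c<..d} \<in> sets lborel" if "h \<in> borel_measurable borel" for h :: "real \<Rightarrow> real"
      using measurable_sets[OF that, of "{c<..d}"] by simp
    have T': "?G -` {c<..d} \<in> sets lborel"
      by (rule vs) simp
    then have [measurable]: "T \<in> sets borel" unfolding T_def sets_lborel by (rule sets.Int) simp
    have k: "?k x \<in> {a..b}" for x using ab by auto
    have kle: "F (?k c) \<le> F (?k d)"
      using True by (intro mono_onD[OF mono k k]) auto
    have clampG: "?G u = G u" if "u \<in> {F a..F b}" for u
      using that by auto
    \<comment> \<open>\<open>T\<close> is only enclosed between two intervals of equal Lebesgue
      measure: if \<open>c < a\<close>, the clamping can add the end point \<open>F a\<close> to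
      it.\<close>
    have 1: "{F (?k c)<..F (?k d)} \<subseteq> T"
    proof
      fix u assume u: "u \<in> {F (?k c)<..F (?k d)}"
      have "F a \<le> F (?k c)" "F (?k d) \<le> F b"
        using ab by (auto intro!: mono_onD[OF mono])
      with u have uab: "u \<in> {F a..F b}" by auto
      note g = FG[OF uab]
      have "?k c < G u"
      proof (rule ccontr)
        assume "\<not> ?k c < G u"
        then have "F (G u) \<le> F (?k c)" using g k by (intro mono_onD[OF mono]) auto
        with g u show False by auto
      qed
      moreover have "G u \<le> ?k d"
      proof (rule ccontr)
        assume *: "\<not> G u \<le> ?k d"
        then have "F (?k d) \<le> F (G u)" using g k by (intro mono_onD[OF mono]) auto
        with g u have "F (?k d) = u" by auto
        with GF[OF k[of d]] * show False by auto
      qed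
      ultimately have "G u \<in> {c<..d}"
        using g ab True by (auto simp: max_def min_def split: if_splits)
      then show "u \<in> T" using uab clampG[OF uab] by (auto simp: T_def)
    qed
    have 2: "T \<subseteq> {F (?k c)..F (?k d)}"
    proof
      fix u assume u: "u \<in> T"
      then have uab: "u \<in> {F a..F b}" by (auto simp: T_def)
      note g = FG[OF uab]
      have gcd: "c < G u" "G u \<le> d" using u clampG[OF uab] by (auto simp: T_def)
      have "F (?k c) \<le> F (G u)"
        by (rule mono_onD[OF mono k]) (use g gcd in \<open>auto simp: max_def min_def\<close>)
      moreover have "F (G u) \<le> F (?k d)"
        by (rule mono_onD[OF mono _ k]) (use g gcd in \<open>auto simp: max_def min_def\<close>)
      ultimately show "u \<in> {F (?k c)..F (?k d)}" using g by auto
    qed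
    have "emeasure lborel {F (?k c)<..F (?k d)} \<le> emeasure lborel T"
      using 1 by (intro emeasure_mono) auto
    moreover have "emeasure lborel T \<le> emeasure lborel {F (?k c)..F (?k d)}"
      using 2 by (intro emeasure_mono) auto
    ultimately have "emeasure lborel T = ennreal (F (?k d) - F (?k c))"
      using kle by simp
    moreover have "emeasure (distr ?N borel ?G) X = emeasure lborel T"
    proof -
      have "emeasure (distr ?N borel ?G) X = emeasure ?N (?G -` {c<..d})"
        unfolding X by (subst emeasure_distr) auto
      also have "\<dots> = emeasure lborel ({F a..F b} \<inter> ?G -` {c<..d})"
        by (rule emeasure_restricted[OF _ T']) simp
      also have "\<dots> = emeasure lborel T"
        by (simp only: T_def Int_commute)
      finally show ?thesis .
    qed
    ultimately show ?thesis
      unfolding X by (simp add: emeasure_stieltjes_Ioc[OF ab mono cont True])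
  qed (simp add: X)
qed auto

lemma nn_integral_stieltjes:
  fixes F G :: "real \<Rightarrow> real"
  assumes ab: "a \<le> b" and mono: "mono_on {a..b} F"
    and F: "continuous_on {a..b} F" and G: "continuous_on {F a..F b} G"
    and GF: "\<And>x. x \<in> {a..b} \<Longrightarrow> G (F x) = x"
    and FG: "\<And>u. u \<in> {F a..F b} \<Longrightarrow> G u \<in> {a..b} \<and> F (G u) = u"
    and [measurable]: "h \<in> borel_measurable borel"
  shows "(\<integral>\<^sup>+t\<in>{a..b}. h t \<partial>stieltjes_measure F a b) = (\<integral>\<^sup>+u\<in>{F a..F b}. h (G u) \<partial>lborel)"
proof -
  let ?G = "\<lambda>u. G (max (F a) (min (F b) u))"
  have Fab: "F a \<le> F b" using mono ab by (auto dest: mono_onD)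
  have [measurable]: "?G \<in> borel_measurable borel"
    by (intro borel_measurable_continuous_onI continuous_on_clamp G Fab)
  have eq: "stieltjes_measure F a b = distr (density lborel (indicator {F a..F b})) borel ?G"
    by (intro stieltjes_measure_eq_distr assms)
  have "(\<integral>\<^sup>+t\<in>{a..b}. h t \<partial>stieltjes_measure F a b) =
    (\<integral>\<^sup>+u. h (?G u) * indicator {a..b} (?G u) \<partial>density lborel (indicator {F a..F b}))"
    unfolding eq by (rule nn_integral_distr) simp_all
  also have "\<dots> = (\<integral>\<^sup>+u. indicator {F a..F b} u * (h (?G u) * indicator {a..b} (?G u)) \<partial>lborel)"
    by (rule nn_integral_density) simp_all
  also have "\<dots> = (\<integral>\<^sup>+u\<in>{F a..F b}. h (G u) \<partial>lborel)"
    using FG by (intro nn_integral_cong) (auto split: split_indicator)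
  finally show ?thesis .
qed

lemma stieltjes_integral_eq_nn_integral:
  fixes F G h :: "real \<Rightarrow> real"
  assumes "a \<le> b" "mono_on {a..b} F"
    "continuous_on {a..b} F" "continuous_on {F a..F b} G"
    "\<And>x. x \<in> {a..b} \<Longrightarrow> G (F x) = x"
    "\<And>u. u \<in> {F a..F b} \<Longrightarrow> G u \<in> {a..b} \<and> F (G u) = u"
    and h[measurable]: "h \<in> borel_measurable borel" and nn: "\<And>x. x \<in> {a..b} \<Longrightarrow> 0 \<le> h x"
  shows "stieltjes_integral a b h F = enn2real (\<integral>\<^sup>+u\<in>{F a..F b}. ennreal (h (G u)) \<partial>lborel)"
proof -
  have "stieltjes_integral a b h F =
      enn2real (\<integral>\<^sup>+t. ennreal (indicator {a..b} t *\<^sub>R h t) \<partial>stieltjes_measure F a b)"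
    unfolding stieltjes_integral_def set_lebesgue_integral_def
    by (rule integral_eq_nn_integral) (use nn in \<open>auto split: split_indicator\<close>)
  also have "(\<integral>\<^sup>+t. ennreal (indicator {a..b} t *\<^sub>R h t) \<partial>stieltjes_measure F a b) =
      (\<integral>\<^sup>+t\<in>{a..b}. ennreal (h t) \<partial>stieltjes_measure F a b)"
    by (intro nn_integral_cong) (auto split: split_indicator)
  also have "\<dots> = (\<integral>\<^sup>+u\<in>{F a..F b}. ennreal (h (G u)) \<partial>lborel)"
    by (rule nn_integral_stieltjes[OF assms(1-6)]) (use h in measurable)
  finally show ?thesis .
qed

section \<open>Arc length and radial metrics\<close>

text \<open>\<open>ennreal\<close> truncates negative numbers to 0. The inequality allows increments
  of either sign to be summed along a curve.\<close>

lemma ennreal_add_le: "ennreal (x + y) \<le> ennreal x + ennreal y"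
proof (cases "0 \<le> x \<and> 0 \<le> y")
  case False
  then have "x + y \<le> x \<or> x + y \<le> y" by linarith
  then show ?thesis
    by (metis add_increasing add_increasing2 ennreal_leI order_refl zero_le)
qed simp

lemma arc_length_ge:
  assumes "mono_on {..n} t" "t 0 = a" "t n = b"
  shows "(\<Sum>i<n. ennreal (dist (\<gamma> (t i)) (\<gamma> (t (Suc i))))) \<le> arc_length \<gamma> a b"
  unfolding arc_length_def using assms by (intro Sup_upper) blast

text \<open>A partition of \<open>[a, u]\<close> followed by \<open>v\<close> is a partition of
  \<open>[a, v]\<close>. This half of additivity already yields monotonicity of the length and
  bounds each chord by the increment of length.\<close>

lemma arc_length_add_dist:
  assumes "a \<le> u" "u \<le> v"
  shows "arc_length \<gamma> a u + ennreal (dist (\<gamma> u) (\<gamma> v)) \<le> arc_length \<gamma> a v"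
proof -
  let ?S = "{\<Sum>i<n. ennreal (dist (\<gamma> (t i)) (\<gamma> (t (Suc i)))) | n t.
            mono_on {..n} t \<and> t 0 = a \<and> t n = u}"
  \<comment> \<open>The partition with the two points \<open>a\<close>, \<open>u\<close> shows that
    the set of sums is nonempty, as needed to move the added constant into the supremum.\<close>
  have "mono_on {..1} (\<lambda>i::nat. if i = 0 then a else u)"
    using \<open>a \<le> u\<close> by (auto simp: mono_on_def)
  then have "?S \<noteq> {}" by fastforce
  then have "arc_length \<gamma> a u + ennreal (dist (\<gamma> u) (\<gamma> v)) = (SUP s\<in>?S. s + ennreal (dist (\<gamma> u) (\<gamma> v)))"
    unfolding arc_length_def by (subst ennreal_SUP_add_left) auto
  also have "\<dots> \<le> arc_length \<gamma> a v"
  proof (rule SUP_least, clarify)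
    fix n and t :: "nat \<Rightarrow> real"
    assume t: "mono_on {..n} t" "a = t 0" "u = t n"
    let ?t = "\<lambda>i. if i \<le> n then t i else v"
    have "mono_on {..Suc n} ?t"
      using t \<open>u \<le> v\<close> by (auto simp: mono_on_def intro: order.trans[of _ "t n"])
    then have "(\<Sum>i<Suc n. ennreal (dist (\<gamma> (?t i)) (\<gamma> (?t (Suc i))))) \<le> arc_length \<gamma> a v"
      using t by (intro arc_length_ge) auto
    also have "(\<Sum>i<Suc n. ennreal (dist (\<gamma> (?t i)) (\<gamma> (?t (Suc i))))) =
        (\<Sum>i<n. ennreal (dist (\<gamma> (t i)) (\<gamma> (t (Suc i))))) + ennreal (dist (\<gamma> (t n)) (\<gamma> v))"
      by simp
    finally show "(\<Sum>i<n. ennreal (dist (\<gamma> (t i)) (\<gamma> (t (Suc i))))) + ennreal (dist (\<gamma> (t n)) (\<gamma> v)) \<le> arc_length \<gamma> (t 0) v"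
      using t by simp
  qed
  finally show ?thesis .
qed

lemma arc_length_mono:
  assumes "a \<le> u" "u \<le> v"
  shows "arc_length \<gamma> a u \<le> arc_length \<gamma> a v"
  using arc_length_add_dist[OF assms, of \<gamma>] by (rule order.trans[OF add_increasing2, rotated 2]) auto

lemma dist_le_arc_length_diff:
  assumes "a \<le> u" "u \<le> v" "arc_length \<gamma> a v < \<infinity>"
  shows "dist (\<gamma> u) (\<gamma> v) \<le> enn2real (arc_length \<gamma> a v) - enn2real (arc_length \<gamma> a u)"
proof -
  have "arc_length \<gamma> a u < \<infinity>"
    using arc_length_mono[OF assms(1,2)] assms(3) by (rule le_less_trans)
  then obtain x y where xy: "arc_length \<gamma> a u = ennreal x" "arc_length \<gamma> a v = ennreal y" "0 \<le> x" "0 \<le> y"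
    using assms(3) by (metis ennreal_cases less_irrefl infinity_ennreal_def)
  then show ?thesis
    using arc_length_add_dist[OF assms(1,2), of \<gamma>] by (simp flip: ennreal_plus)
qed

text \<open>Take a partition of \<open>[a, v]\<close> whose chord sum misses the length by less than
  \<open>e / 2\<close>. On every cell the length exceeds the chord by a nonnegative amount, and
  these excesses sum to less than \<open>e / 2\<close>. On the cell containing \<open>p\<close> the
  increment of length is therefore at most the chord plus \<open>e / 2\<close>, and the chord beyond
  \<open>p\<close> is short by continuity of \<open>\<gamma>\<close>.\<close>

lemma arc_length_continuous_at_right:
  assumes ap: "a \<le> p" and pb: "p < b" and fin: "arc_length \<gamma> a b < \<infinity>"
    and cont: "continuous_on {a..b} \<gamma>"
  shows "((\<lambda>s. enn2real (arc_length \<gamma> a s)) \<longlongrightarrow> enn2real (arc_length \<gamma> a p)) (at_right p)"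
proof (rule tendstoI)
  fix e :: real assume e: "e > 0"
  define F where "F = (\<lambda>s. enn2real (arc_length \<gamma> a s))"
  have fin': "arc_length \<gamma> a v < \<infinity>" if "a \<le> v" "v \<le> b" for v
    using arc_length_mono[OF that, of \<gamma>] fin by (rule le_less_trans)
  have F0: "0 \<le> F v" for v by (simp add: F_def)
  have FF: "arc_length \<gamma> a v = ennreal (F v)" if "a \<le> v" "v \<le> b" for v
    using fin'[OF that] by (simp add: F_def)
  have D: "dist (\<gamma> u) (\<gamma> v) \<le> F v - F u" if "a \<le> u" "u \<le> v" "v \<le> b" for u v
    using dist_le_arc_length_diff[of a u v \<gamma>] that fin'[of v] by (auto simp: F_def)
  have M: "F u \<le> F v" if "a \<le> u" "u \<le> v" "v \<le> b" for u v
    using D[OF that] zero_le_dist[of "\<gamma> u" "\<gamma> v"] by linarith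
  have "(\<gamma> \<longlongrightarrow> \<gamma> p) (at_right p)"
    using continuous_on_Icc_at_rightD[of p b \<gamma>] continuous_on_subset[OF cont, of "{p..b}"] ap pb by auto
  then have "\<forall>\<^sub>F x in at_right p. dist (\<gamma> x) (\<gamma> p) < e / 2"
    using e by (intro tendstoD) auto
  then obtain q where q: "q > p" "\<And>x. p < x \<Longrightarrow> x < q \<Longrightarrow> dist (\<gamma> x) (\<gamma> p) < e / 2"
    by (auto simp: eventually_at_right_field)
  define v where "v = (p + min q b) / 2"
  have v: "p < v" "v < q" "v < b" "v \<le> b" using q pb by (auto simp: v_def min_def)
  have "\<exists>w>p. w \<le> b \<and> F w < F p + e"
  proof (cases "F v < F p + e")
    case False
    then have pos: "0 \<le> F v - e / 2" "F v > 0"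
      using e F0[of p] by linarith+
    have "ennreal (F v - e / 2) < arc_length \<gamma> a v"
      using pos e v ap by (subst FF) (auto intro!: ennreal_lessI)
    then obtain n t where t: "mono_on {..n} t" "t 0 = a" "t n = v"
      and "ennreal (F v - e / 2) < (\<Sum>i<n. ennreal (dist (\<gamma> (t i)) (\<gamma> (t (Suc i)))))"
      unfolding arc_length_def less_Sup_iff by blast
    then have sum: "F v - e / 2 < (\<Sum>i<n. dist (\<gamma> (t i)) (\<gamma> (t (Suc i))))"
      using pos by (simp add: sum_nonneg ennreal_less_iff)
    have tin: "a \<le> t i" "t i \<le> v" if "i \<le> n" for i
      using mono_onD[OF t(1), of 0 i] mono_onD[OF t(1), of i n] that t by auto
    have tmono: "t i \<le> t (Suc i)" if "i < n" for i
      using mono_onD[OF t(1), of i "Suc i"] that by auto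
    \<comment> \<open>\<open>j\<close> is the index of the cell with
      \<open>t j <= p < t (Suc j)\<close>; it exists because \<open>t n = v > p\<close>.\<close>
    define j where "j = (LEAST k. t (Suc k) > p)"
    have "n \<noteq> 0" using t v ap by (cases "n = 0") auto
    then have ex: "t (Suc (n - 1)) > p" using t v by auto
    have j1: "t (Suc j) > p" unfolding j_def by (rule LeastI[of _ "n-1"]) (rule ex)
    have jn: "j < n" using Least_le[of "\<lambda>k. t (Suc k) > p" "n - 1", OF ex] \<open>n \<noteq> 0\<close>
      unfolding j_def[symmetric] by auto
    have j2: "t j \<le> p"
    proof (cases j)
      case (Suc k)
      then show ?thesis using not_less_Least[of k "\<lambda>k. t (Suc k) > p"] unfolding j_def[symmetric] by auto
    qed (use t ap in auto)
    \<comment> \<open>One nonnegative excess is bounded by the sum of all of them, which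
      telescopes.\<close>
    have "F (t (Suc j)) - F (t j) - dist (\<gamma> (t j)) (\<gamma> (t (Suc j))) \<le>
       (\<Sum>i<n. F (t (Suc i)) - F (t i) - dist (\<gamma> (t i)) (\<gamma> (t (Suc i))))"
    proof (rule member_le_sum)
      fix i assume "i \<in> {..<n} - {j}"
      then have "i < n" by auto
      then show "0 \<le> F (t (Suc i)) - F (t i) - dist (\<gamma> (t i)) (\<gamma> (t (Suc i)))"
        using D[OF tin(1)[of i] tmono[of i]] tin(2)[of "Suc i"] v by auto
    qed (use jn in auto)
    also have "\<dots> = F v - F a - (\<Sum>i<n. dist (\<gamma> (t i)) (\<gamma> (t (Suc i))))"
      using t sum_lessThan_telescope[of "\<lambda>i. F (t i)" n] by (simp add: sum_subtractf)
    also have "\<dots> < e / 2"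
      using sum F0[of a] by linarith
    finally have "F (t (Suc j)) < F (t j) + dist (\<gamma> (t j)) (\<gamma> (t (Suc j))) + e / 2" by simp
    also have "\<dots> \<le> F (t j) + dist (\<gamma> (t j)) (\<gamma> p) + dist (\<gamma> (t (Suc j))) (\<gamma> p) + e / 2"
      using dist_triangle2[of "\<gamma> (t j)" "\<gamma> (t (Suc j))" "\<gamma> p"] by simp
    \<comment> \<open>The chord from \<open>t j\<close> to \<open>p\<close> is absorbed by
      \<open>F p - F (t j)\<close>, and the one from \<open>p\<close> to \<open>t (Suc j)\<close> is
      below \<open>e / 2\<close> because \<open>t (Suc j) <= v < q\<close>.\<close>
    also have "\<dots> \<le> F p + e"
      using D[of "t j" p] tin(1)[of j] j2 pb jn q(2)[of "t (Suc j)"] j1 tin(2)[of "Suc j"] v by auto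
    finally have "F (t (Suc j)) < F p + e" .
    then show ?thesis using j1 tin(2)[of "Suc j"] jn v by (intro exI[of _ "t (Suc j)"]) auto
  qed (use v in auto)
  then obtain w where w: "w > p" "w \<le> b" "F w < F p + e" by blast
  have "dist (F x) (F p) < e" if "p < x" "x < w" for x
    using M[of p x] M[of x w] that w ap by (auto simp: dist_real_def)
  then show "\<forall>\<^sub>F s in at_right p. dist (enn2real (arc_length \<gamma> a s)) (enn2real (arc_length \<gamma> a p)) < e"
    unfolding eventually_at_right_field F_def using w by blast
qed

text \<open>
  The distance to the origin is 1-Lipschitz with respect to arc length, so a radial density
  integrates along the curve to at least the increment of its radial primitive.
\<close>
lemma stieltjes_arc_length_ge:
  fixes \<gamma> :: "real \<Rightarrow> complex" and f H :: "real \<Rightarrow> real"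
  assumes ab: "a \<le> b" and fin: "arc_length \<gamma> a b < \<infinity>" and cont: "continuous_on {a..b} \<gamma>"
    and im: "\<And>t. t \<in> {a..b} \<Longrightarrow> cmod (\<gamma> t) \<in> {r..R}"
    and f: "continuous_on {r..R} f" and fnn: "\<And>x. x \<in> {r..R} \<Longrightarrow> 0 \<le> f x"
    and H: "\<And>x. x \<in> {r..R} \<Longrightarrow> (H has_real_derivative f x) (at x within {r..R})"
  shows "ennreal (H (cmod (\<gamma> b)) - H (cmod (\<gamma> a))) \<le>
    (\<integral>\<^sup>+t\<in>{a..b}. ennreal (f (cmod (\<gamma> t))) \<partial>stieltjes_measure (\<lambda>s. enn2real (arc_length \<gamma> a s)) a b)"
proof -
  define F where "F = (\<lambda>s. enn2real (arc_length \<gamma> a s))"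
  define M where "M = stieltjes_measure F a b"
  define h where "h = (\<lambda>t. f (cmod (\<gamma> t)))"
  have D: "dist (\<gamma> u) (\<gamma> v) \<le> F v - F u" if "a \<le> u" "u \<le> v" "v \<le> b" for u v
    using dist_le_arc_length_diff[of a u v \<gamma>] that arc_length_mono[of a v b \<gamma>] fin by (auto simp: F_def)
  have mono: "mono_on {a..b} F"
  proof (rule mono_onI)
    fix u v assume "u \<in> {a..b}" "v \<in> {a..b}" "u \<le> v"
    then show "F u \<le> F v" using D[of u v] zero_le_dist[of "\<gamma> u" "\<gamma> v"] by (simp del: zero_le_dist)
  qed
  have emM: "emeasure M {u<..v} = ennreal (F v - F u)" if "a \<le> u" "u \<le> v" "v \<le> b" for u v
    unfolding M_def F_def
    using arc_length_continuous_at_right[OF _ _ fin cont] mono that ab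
    by (subst emeasure_stieltjes_Ioc) (auto simp: F_def)
  have hcont: "continuous_on {a..b} h"
    unfolding h_def by (rule continuous_on_compose2[OF f]) (use im cont in \<open>auto intro!: continuous_intros\<close>)
  have hnn: "0 \<le> h t" if "t \<in> {a..b}" for t
    using fnn im that by (auto simp: h_def)
  have hm: "(\<lambda>t. ennreal (h t) * indicator {a..b} t) \<in> borel_measurable borel"
  proof -
    have "(\<lambda>t. indicator {a..b} t *\<^sub>R h t) \<in> borel_measurable borel"
      by (rule borel_measurable_continuous_on_indicator[OF _ hcont]) auto
    then have "(\<lambda>t. ennreal (indicator {a..b} t *\<^sub>R h t)) \<in> borel_measurable borel" by measurable
    also have "(\<lambda>t. ennreal (indicator {a..b} t *\<^sub>R h t)) = (\<lambda>t. ennreal (h t) * indicator {a..b} t)"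
      by (auto split: split_indicator)
    finally show ?thesis .
  qed
  have main: "ennreal (H (cmod (\<gamma> b)) - H (cmod (\<gamma> a))) \<le>
     (\<integral>\<^sup>+t\<in>{a..b}. ennreal (h t) \<partial>M) + ennreal e * ennreal (F b - F a)" if e: "e > 0" for e
  proof -
    have "uniformly_continuous_on {a..b} h"
      by (intro compact_uniformly_continuous hcont) auto
    then obtain d where d: "d > 0"
      and dd: "\<And>x y. x \<in> {a..b} \<Longrightarrow> y \<in> {a..b} \<Longrightarrow> dist y x < d \<Longrightarrow> dist (h y) (h x) < e"
      unfolding uniformly_continuous_on_def using e by metis
    \<comment> \<open>Raising \<open>h\<close> by the oscillation bound \<open>e\<close> makes
      \<open>k\<close> dominate every single value of \<open>h\<close> on a cell shorter than
      \<open>d\<close>.\<close>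
    define k where "k = (\<lambda>t. (ennreal (h t) + ennreal e) * indicator {a..b} t)"
    have km[measurable]: "k \<in> borel_measurable borel"
    proof -
      have "k = (\<lambda>t. ennreal (h t) * indicator {a..b} t + ennreal e * indicator {a..b} t)"
        by (auto simp: k_def split: split_indicator)
      then show ?thesis using hm by simp
    qed
    have step: "ennreal (H (cmod (\<gamma> v)) - H (cmod (\<gamma> u))) \<le> (\<integral>\<^sup>+t\<in>{u<..v}. k t \<partial>M)"
      if uv: "a \<le> u" "u \<le> v" "v \<le> b" "v - u < d" for u v
    proof -
      \<comment> \<open>If the radius grows, the mean value theorem gives an intermediate radius and
        the intermediate value theorem a parameter \<open>x\<close> with that radius. The growth of
        the radius is at most the chord, hence at most \<open>F v - F u\<close>. If the radius does
        not grow, the left side is not positive and \<open>x = u\<close> serves.\<close>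
      have "\<exists>x\<in>{u..v}. H (cmod (\<gamma> v)) - H (cmod (\<gamma> u)) \<le> h x * (F v - F u)"
      proof (cases "cmod (\<gamma> u) < cmod (\<gamma> v)")
        case True
        obtain \<xi> where \<xi>: "\<xi> \<in> {cmod (\<gamma> u)<..<cmod (\<gamma> v)}"
          "H (cmod (\<gamma> v)) - H (cmod (\<gamma> u)) = (cmod (\<gamma> v) - cmod (\<gamma> u)) * f \<xi>"
        proof -
          have sub: "{cmod (\<gamma> u)..cmod (\<gamma> v)} \<subseteq> {r..R}" using im[of u] im[of v] uv by auto
          have "\<exists>\<xi>\<in>{cmod (\<gamma> u)<..<cmod (\<gamma> v)}. H (cmod (\<gamma> v)) - H (cmod (\<gamma> u)) = (\<lambda>y. f \<xi> * y) (cmod (\<gamma> v) - cmod (\<gamma> u))"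
          proof (rule mvt_simple[OF True])
            fix x assume "cmod (\<gamma> u) \<le> x" "x \<le> cmod (\<gamma> v)"
            then have "(H has_real_derivative f x) (at x within {cmod (\<gamma> u)..cmod (\<gamma> v)})"
              using H[of x] sub by (auto intro: DERIV_subset)
            then show "(H has_derivative (*) (f x)) (at x within {cmod (\<gamma> u)..cmod (\<gamma> v)})"
              by (simp add: has_field_derivative_def)
          qed
          then show ?thesis using that by (auto simp: mult.commute)
        qed
        have "\<exists>x\<ge>u. x \<le> v \<and> cmod (\<gamma> x) = \<xi>"
          by (rule IVT') (use \<xi> uv in \<open>auto intro!: continuous_intros continuous_on_subset[OF cont]\<close>)
        then obtain x where x: "x \<in> {u..v}" "cmod (\<gamma> x) = \<xi>" by auto
        have "cmod (\<gamma> v) - cmod (\<gamma> u) \<le> F v - F u"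
          using norm_triangle_ineq2[of "\<gamma> v" "\<gamma> u"] D[of u v] uv by (simp add: dist_norm norm_minus_commute)
        then have "(cmod (\<gamma> v) - cmod (\<gamma> u)) * h x \<le> (F v - F u) * h x"
          using hnn[of x] x uv by (intro mult_right_mono) auto
        then show ?thesis using x \<xi> by (intro bexI[of _ x]) (auto simp: h_def mult.commute)
      next
        case False
        have "H (cmod (\<gamma> v)) \<le> H (cmod (\<gamma> u))"
        proof (cases "cmod (\<gamma> u) = cmod (\<gamma> v)")
          case ne: False
          have sub: "{cmod (\<gamma> v)..cmod (\<gamma> u)} \<subseteq> {r..R}" using im[of u] im[of v] uv by auto
          have "\<exists>\<xi>\<in>{cmod (\<gamma> v)<..<cmod (\<gamma> u)}. H (cmod (\<gamma> u)) - H (cmod (\<gamma> v)) = (\<lambda>y. f \<xi> * y) (cmod (\<gamma> u) - cmod (\<gamma> v))"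
          proof (rule mvt_simple)
            fix x assume "cmod (\<gamma> v) \<le> x" "x \<le> cmod (\<gamma> u)"
            then have "(H has_real_derivative f x) (at x within {cmod (\<gamma> v)..cmod (\<gamma> u)})"
              using H[of x] sub by (auto intro: DERIV_subset)
            then show "(H has_derivative (*) (f x)) (at x within {cmod (\<gamma> v)..cmod (\<gamma> u)})"
              by (simp add: has_field_derivative_def)
          qed (use False ne in auto)
          then obtain \<xi> where \<xi>: "\<xi> \<in> {cmod (\<gamma> v)<..<cmod (\<gamma> u)}"
            "H (cmod (\<gamma> u)) - H (cmod (\<gamma> v)) = f \<xi> * (cmod (\<gamma> u) - cmod (\<gamma> v))" by auto
          moreover have "f \<xi> * (cmod (\<gamma> u) - cmod (\<gamma> v)) \<ge> 0"
            using \<xi> sub False by (intro mult_nonneg_nonneg fnn) auto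
          ultimately show ?thesis by linarith
        qed simp
        moreover have "h u * (F v - F u) \<ge> 0"
          using order.trans[OF zero_le_dist D[of u v]] uv hnn[of u] by (intro mult_nonneg_nonneg) auto
        ultimately show ?thesis using uv by (intro bexI[of _ u]) auto
      qed
      then obtain x where x: "x \<in> {u..v}" "H (cmod (\<gamma> v)) - H (cmod (\<gamma> u)) \<le> h x * (F v - F u)" by blast
      have hx: "h x \<ge> 0" using hnn[of x] x uv by auto
      have "ennreal (H (cmod (\<gamma> v)) - H (cmod (\<gamma> u))) \<le> ennreal (h x) * ennreal (F v - F u)"
        using x hx order.trans[OF zero_le_dist D[of u v]] uv by (subst ennreal_mult[symmetric]) (auto intro: ennreal_leI)
      also have "\<dots> = (\<integral>\<^sup>+t\<in>{u<..v}. ennreal (h x) \<partial>M)"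
        using emM[of u v] uv by (subst nn_integral_cmult_indicator) (auto simp: M_def)
      also have "\<dots> \<le> (\<integral>\<^sup>+t\<in>{u<..v}. k t \<partial>M)"
      proof (rule nn_integral_mono)
        fix t
        have "ennreal (h x) \<le> k t" if "t \<in> {u<..v}"
        proof -
          have "dist (h x) (h t) < e" using that x uv by (intro dd) (auto simp: dist_real_def)
          then have "h x \<le> h t + e" by (auto simp: dist_real_def)
          moreover have "0 \<le> h t" using hnn[of t] that uv by auto
          ultimately show ?thesis using that uv e by (auto simp: k_def intro!: ennreal_leI simp flip: ennreal_plus)
        qed
        then show "ennreal (h x) * indicator {u<..v} t \<le> k t * indicator {u<..v} t"
          by (auto split: split_indicator)
      qed
      finally show ?thesis .
    qed
    obtain n :: nat where n: "(b - a) / d < real n" using reals_Archimedean2 by blast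
    then have n0: "n > 0" using d ab by (cases n) (auto simp: divide_less_0_iff not_less)
    define x where "x = (\<lambda>i. a + real i * ((b - a) / real n))"
    have xn: "x n = b" "x 0 = a" using n0 by (auto simp: x_def)
    have xs: "x (Suc i) - x i = (b - a) / real n" for i by (simp add: x_def algebra_simps add_divide_distrib diff_divide_distrib)
    have small: "(b - a) / real n < d" using n n0 d by (simp add: field_simps)
    have xle: "a \<le> x i" for i using ab by (auto simp: x_def)
    have xm: "x i \<le> x j" if "i \<le> j" for i j
      unfolding x_def using ab that by (intro add_left_mono mult_right_mono) auto
    \<comment> \<open>The half-open cells \<open>{x i<..x (Suc i)}\<close> are disjoint, so the
      estimates of the steps add up without counting atoms twice.\<close>
    have "i \<le> n \<Longrightarrow> ennreal (H (cmod (\<gamma> (x i))) - H (cmod (\<gamma> a))) \<le> (\<integral>\<^sup>+t\<in>{a<..x i}. k t \<partial>M)" for i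
    proof (induction i)
      case (Suc i)
      have "ennreal (H (cmod (\<gamma> (x (Suc i)))) - H (cmod (\<gamma> a))) \<le>
         ennreal (H (cmod (\<gamma> (x i))) - H (cmod (\<gamma> a))) + ennreal (H (cmod (\<gamma> (x (Suc i)))) - H (cmod (\<gamma> (x i))))"
        using ennreal_add_le[of "H (cmod (\<gamma> (x i))) - H (cmod (\<gamma> a))" "H (cmod (\<gamma> (x (Suc i)))) - H (cmod (\<gamma> (x i)))"] by simp
      also have "\<dots> \<le> (\<integral>\<^sup>+t\<in>{a<..x i}. k t \<partial>M) + (\<integral>\<^sup>+t\<in>{x i<..x (Suc i)}. k t \<partial>M)"
      proof (rule add_mono[OF _ step])
        show "x (Suc i) - x i < d" using xs small by simp
        show "x (Suc i) \<le> b" using xm[of "Suc i" n] xn Suc.prems by simp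
      qed (use Suc xm[of i "Suc i"] xle in auto)
      also have "\<dots> = (\<integral>\<^sup>+t. k t * indicator {a<..x i} t + k t * indicator {x i<..x (Suc i)} t \<partial>M)"
        by (rule nn_integral_add[symmetric]) (auto simp: M_def)
      also have "\<dots> = (\<integral>\<^sup>+t\<in>{a<..x (Suc i)}. k t \<partial>M)"
        using xm[of i "Suc i"] xle[of i] by (intro nn_integral_cong) (auto split: split_indicator)
      finally show ?case .
    qed (simp add: xn)
    from this[of n] have "ennreal (H (cmod (\<gamma> b)) - H (cmod (\<gamma> a))) \<le> (\<integral>\<^sup>+t\<in>{a<..b}. k t \<partial>M)"
      by (simp add: xn)
    also have "\<dots> \<le> (\<integral>\<^sup>+t. ennreal (h t) * indicator {a..b} t + ennreal e * indicator {a<..b} t \<partial>M)"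
      by (intro nn_integral_mono) (auto simp: k_def split: split_indicator)
    also have "\<dots> = (\<integral>\<^sup>+t\<in>{a..b}. ennreal (h t) \<partial>M) + (\<integral>\<^sup>+t\<in>{a<..b}. ennreal e \<partial>M)"
      using hm by (intro nn_integral_add) (auto simp: M_def)
    also have "(\<integral>\<^sup>+t\<in>{a<..b}. ennreal e \<partial>M) = ennreal e * ennreal (F b - F a)"
      using emM[of a b] ab by (subst nn_integral_cmult_indicator) (auto simp: M_def)
    finally show ?thesis .
  qed
  have "ennreal (H (cmod (\<gamma> b)) - H (cmod (\<gamma> a))) \<le> (\<integral>\<^sup>+t\<in>{a..b}. ennreal (h t) \<partial>M)"
  proof (rule ennreal_le_epsilon)
    fix e :: real assume e: "0 < e"
    have "F b - F a \<ge> 0" using D[of a b] ab zero_le_dist[of "\<gamma> a" "\<gamma> b"] by linarith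
    \<comment> \<open>The slack costs \<open>e\<close> times the length of the curve, so it is
      rescaled by the length; the \<open>+ 1\<close> covers a curve of length 0.\<close>
    then have "e / (F b - F a + 1) * (F b - F a) \<le> e" using e by (simp add: field_simps)
    then have "ennreal (e / (F b - F a + 1)) * ennreal (F b - F a) \<le> ennreal e"
      using \<open>F b - F a \<ge> 0\<close> e by (subst ennreal_mult[symmetric]) (auto intro: ennreal_leI)
    then show "ennreal (H (cmod (\<gamma> b)) - H (cmod (\<gamma> a))) \<le> (\<integral>\<^sup>+t\<in>{a..b}. ennreal (h t) \<partial>M) + ennreal e"
      using main[of "e / (F b - F a + 1)"] e \<open>F b - F a \<ge> 0\<close> by (auto intro: order.trans add_left_mono)
  qed
  then show ?thesis by (simp add: h_def M_def F_def)
qed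

text \<open>Along a compact subcurve the metric integrates to at least the increment of the
  primitive \<open>H\<close> between the two radii. A joining curve has no end points, so the full
  increment \<open>H R - H r >= 1\<close> is reached as a limit over growing subcurves, by
  continuity of \<open>H\<close> up to both end radii.\<close>

lemma admissible_radial:
  fixes f :: "real \<Rightarrow> real"
  assumes r: "0 < r" "r < R" and f: "continuous_on {r..R} f"
    and fnn: "\<And>x. x \<in> {r..R} \<Longrightarrow> 0 \<le> f x" and int: "1 \<le> integral {r..R} f"
  shows "admissible (\<lambda>z. ennreal (f (cmod z)) * indicator (annulus r R) z) (joining_curves r R)"
    (is "admissible ?\<rho> _")
  unfolding admissible_def
proof (intro conjI ballI impI)
  have "(\<lambda>s. indicator {r..R} s *\<^sub>R f s) \<in> borel_measurable borel"
    by (rule borel_measurable_continuous_on_indicator[OF _ f]) auto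
  then have [measurable]: "(\<lambda>s. indicator {r..R} s * f s) \<in> borel_measurable borel" by simp
  have "?\<rho> = (\<lambda>z. ennreal (indicator {r..R} (cmod z) * f (cmod z)) * indicator {r<..<R} (cmod z))"
    by (auto simp: annulus_def split: split_indicator)
  also have "\<dots> \<in> borel_measurable borel" by measurable
  finally show "?\<rho> \<in> borel_measurable borel" .
next
  fix \<gamma> assume \<gamma>: "\<gamma> \<in> joining_curves r R" and rect: "locally_rectifiable \<gamma>"
  define H where "H = (\<lambda>x. integral {r..x} f)"
  have H: "(H has_real_derivative f x) (at x within {r..R})" if "x \<in> {r..R}" for x
    unfolding H_def by (rule integral_has_real_derivative[OF f that])
  then have Hc: "continuous_on {r..R} H"
    by (meson DERIV_continuous continuous_on_eq_continuous_within)
  have cont: "continuous_on {0<..<1} \<gamma>" and im: "\<And>t. 0 < t \<Longrightarrow> t < 1 \<Longrightarrow> \<gamma> t \<in> annulus r R"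
    and lim: "((\<lambda>t. cmod (\<gamma> t)) \<longlongrightarrow> r) (at_right 0)" "((\<lambda>t. cmod (\<gamma> t)) \<longlongrightarrow> R) (at_left 1)"
    using \<gamma> by (auto simp: joining_curves_def)
  have im': "cmod (\<gamma> t) \<in> {r..R}" if "0 < t" "t < 1" for t
    using im[OF that] by (auto simp: annulus_def)
  have le: "ennreal (H (cmod (\<gamma> b)) - H (cmod (\<gamma> a))) \<le> curve_integral ?\<rho> \<gamma>"
    if ab: "0 < a" "a \<le> b" "b < 1" for a b
  proof -
    have "ennreal (H (cmod (\<gamma> b)) - H (cmod (\<gamma> a))) \<le>
      (\<integral>\<^sup>+t\<in>{a..b}. ennreal (f (cmod (\<gamma> t))) \<partial>stieltjes_measure (\<lambda>s. enn2real (arc_length \<gamma> a s)) a b)"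
      using ab rect im' cont
      by (intro stieltjes_arc_length_ge[OF _ _ _ _ f fnn H])
        (auto simp: locally_rectifiable_def intro: continuous_on_subset)
    also have "\<dots> = (\<integral>\<^sup>+t\<in>{a..b}. ?\<rho> (\<gamma> t) \<partial>stieltjes_measure (\<lambda>s. enn2real (arc_length \<gamma> a s)) a b)"
      using ab im by (intro nn_integral_cong) (auto split: split_indicator)
    also have "\<dots> \<le> curve_integral ?\<rho> \<gamma>"
      unfolding curve_integral_def using ab by (intro Sup_upper) blast
    finally show ?thesis .
  qed
  \<comment> \<open>The shift by 2 keeps \<open>inverse (real (n + 2))\<close> at most 1/2, so that
    it never exceeds \<open>1 - inverse (real (n + 2))\<close>.\<close>
  have seq: "(\<lambda>n. inverse (real (n + 2))) \<longlonglongrightarrow> 0"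
    using LIMSEQ_ignore_initial_segment[OF LIMSEQ_inverse_real_of_nat, of 1] by simp
  have seq0: "filterlim (\<lambda>n. inverse (real (n + 2))) (at_right 0) sequentially"
    unfolding filterlim_at using seq by simp
  have seq1: "filterlim (\<lambda>n. 1 - inverse (real (n + 2))) (at_left 1) sequentially"
    unfolding filterlim_at using tendsto_diff[OF tendsto_const seq, of 1] by (simp add: field_simps)
  have "(\<lambda>n. H (cmod (\<gamma> (inverse (real (n + 2)))))) \<longlonglongrightarrow> H r"
    using im' r by (intro continuous_on_tendsto_compose[OF Hc filterlim_compose[OF lim(1) seq0]])
      (auto simp: field_simps)
  moreover have "(\<lambda>n. H (cmod (\<gamma> (1 - inverse (real (n + 2)))))) \<longlonglongrightarrow> H R"
    using im' r by (intro continuous_on_tendsto_compose[OF Hc filterlim_compose[OF lim(2) seq1]])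
      (auto simp: field_simps)
  ultimately have "(\<lambda>n. ennreal (H (cmod (\<gamma> (1 - inverse (real (n + 2))))) - H (cmod (\<gamma> (inverse (real (n + 2)))))))
      \<longlonglongrightarrow> ennreal (H R - H r)"
    by (intro tendsto_ennrealI tendsto_diff)
  moreover have "ennreal (H (cmod (\<gamma> (1 - inverse (real (n + 2))))) - H (cmod (\<gamma> (inverse (real (n + 2))))))
      \<le> curve_integral ?\<rho> \<gamma>" for n
    by (rule le) (auto simp: field_simps)
  ultimately have "ennreal (H R - H r) \<le> curve_integral ?\<rho> \<gamma>"
    by (intro LIMSEQ_le_const2) auto
  moreover have "1 \<le> ennreal (H R - H r)"
    using int by (auto simp: H_def simp flip: ennreal_1 intro!: ennreal_leI)
  ultimately show "1 \<le> curve_integral ?\<rho> \<gamma>" by (rule order.trans[rotated])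
qed

section \<open>Radial weights\<close>

text \<open>On a segment the chord sums telescope, so every partition gives the same value.\<close>

lemma arc_length_segment:
  fixes c d :: complex
  assumes "a \<le> b"
  shows "arc_length (\<lambda>t. d + of_real t * c) a b = ennreal (cmod c * (b - a))"
proof -
  have *: "(\<Sum>i<n. ennreal (dist (d + of_real (t i) * c) (d + of_real (t (Suc i)) * c))) = ennreal (cmod c * (b - a))"
    if t: "mono_on {..n} t" "t 0 = a" "t n = b" for n and t :: "nat \<Rightarrow> real"
  proof -
    have "dist (d + of_real (t i) * c) (d + of_real (t (Suc i)) * c) = cmod c * (t (Suc i) - t i)" if "i < n" for i
    proof -
      have "t i \<le> t (Suc i)" using mono_onD[OF t(1), of i "Suc i"] that by auto
      moreover have "dist (d + of_real (t i) * c) (d + of_real (t (Suc i)) * c) = cmod (of_real (t i - t (Suc i)) * c)"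
        by (simp add: dist_norm algebra_simps)
      ultimately show ?thesis by (simp only: norm_mult norm_of_real) simp
    qed
    then have "(\<Sum>i<n. dist (d + of_real (t i) * c) (d + of_real (t (Suc i)) * c)) = (\<Sum>i<n. cmod c * (t (Suc i) - t i))"
      by (intro sum.cong) auto
    also have "\<dots> = cmod c * (b - a)"
      using t by (simp only: flip: sum_distrib_left) (simp add: sum_lessThan_telescope)
    finally show ?thesis by (subst sum_ennreal) auto
  qed
  show ?thesis
  proof (rule antisym)
    show "arc_length (\<lambda>t. d + of_real t * c) a b \<le> ennreal (cmod c * (b - a))"
      unfolding arc_length_def
    proof (rule Sup_least, clarify)
      fix n and t :: "nat \<Rightarrow> real"
      assume "mono_on {..n} t" "a = t 0" "b = t n"
      then show "(\<Sum>i<n. ennreal (dist (d + of_real (t i) * c) (d + of_real (t (Suc i)) * c))) \<le>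
          ennreal (cmod c * (t n - t 0))"
        using *[of n t] by simp
    qed
    let ?t = "\<lambda>i::nat. if i = 0 then a else b"
    have t: "mono_on {..1} ?t" "?t 0 = a" "?t 1 = b"
      using assms by (auto simp: mono_on_def)
    show "ennreal (cmod c * (b - a)) \<le> arc_length (\<lambda>t. d + of_real t * c) a b"
      using arc_length_ge[OF t, of "\<lambda>t. d + of_real t * c"] unfolding *[OF t] .
  qed
qed

lemma curve_integral_radial_segment:
  fixes c :: complex
  assumes r: "0 < r" "r < R" and c: "cmod c = 1"
  defines "\<gamma> \<equiv> \<lambda>t. of_real r * c + of_real t * (of_real (R - r) * c)"
  shows radial_segment_joining: "\<gamma> \<in> joining_curves r R"
    and radial_segment_rectifiable: "locally_rectifiable \<gamma>"
    and curve_integral_radial_segment_le: "\<And>\<rho>. \<rho> \<in> borel_measurable borel \<Longrightarrow>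
      curve_integral \<rho> \<gamma> \<le> (\<integral>\<^sup>+s\<in>{r<..<R}. \<rho> (of_real s * c) \<partial>lborel)"
proof -
  have \<gamma>: "\<gamma> t = of_real (r + t * (R - r)) * c" for t
    by (simp add: \<gamma>_def algebra_simps)
  have nc: "cmod (of_real (R - r) * c) = R - r"
    using r c by (simp only: norm_mult norm_of_real) simp
  have L: "arc_length \<gamma> a b = ennreal ((R - r) * (b - a))" if "a \<le> b" for a b
    using arc_length_segment[OF that, of "of_real r * c" "of_real (R - r) * c"] unfolding nc \<gamma>_def .
  show "locally_rectifiable \<gamma>"
    unfolding locally_rectifiable_def by (auto simp: L)
  have cm: "cmod (\<gamma> t) = r + t * (R - r)" if "0 < t" for t
  proof -
    have "0 \<le> r + t * (R - r)" using r that by simp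
    then show ?thesis unfolding \<gamma> using c by (simp only: norm_mult norm_of_real) simp
  qed
  have lims: "((\<lambda>t. r + t * (R - r)) \<longlongrightarrow> r + x * (R - r)) (at x within S)" for x S
    by (intro tendsto_intros)
  show "\<gamma> \<in> joining_curves r R"
    unfolding joining_curves_def
  proof (intro CollectI conjI)
    show "continuous_on {0<..<1} \<gamma>" unfolding \<gamma>_def by (intro continuous_intros)
    show "\<gamma> ` {0<..<1} \<subseteq> annulus r R"
    proof
      fix z assume "z \<in> \<gamma> ` {0<..<1}"
      then obtain t where t: "0 < t" "t < 1" "z = \<gamma> t" by auto
      have "t * (R - r) < 1 * (R - r)" using t r by (intro mult_strict_right_mono) (auto simp del: mult_1)
      then have "r + t * (R - r) < R" by simp
      then show "z \<in> annulus r R" using t r by (simp add: annulus_def cm)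
    qed
    show "((\<lambda>t. cmod (\<gamma> t)) \<longlongrightarrow> r) (at_right 0)"
      by (rule Lim_transform_eventually[OF lims[of 0, simplified]])
        (auto simp: eventually_at_right_field cm intro!: exI[of _ 1])
    show "((\<lambda>t. cmod (\<gamma> t)) \<longlongrightarrow> R) (at_left 1)"
      by (rule Lim_transform_eventually[OF lims[of 1, simplified]])
        (auto simp: eventually_at_left_field cm intro!: exI[of _ 0])
  qed
  fix \<rho> :: "complex \<Rightarrow> ennreal" assume [measurable]: "\<rho> \<in> borel_measurable borel"
  have [measurable]: "\<gamma> \<in> borel_measurable borel" unfolding \<gamma>_def by measurable
  show "curve_integral \<rho> \<gamma> \<le> (\<integral>\<^sup>+s\<in>{r<..<R}. \<rho> (of_real s * c) \<partial>lborel)"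
    unfolding curve_integral_def
  proof (rule Sup_least, clarify)
    fix a b :: real assume ab: "0 < a" "a \<le> b" "b < 1"
    define F where "F = (\<lambda>s. enn2real (arc_length \<gamma> a s))"
    have F: "F s = (R - r) * (s - a)" if "s \<in> {a..b}" for s
      using that r by (simp add: F_def L)
    let ?G = "\<lambda>u. a + u / (R - r)"
    have "(\<integral>\<^sup>+t\<in>{a..b}. \<rho> (\<gamma> t) \<partial>stieltjes_measure F a b) = (\<integral>\<^sup>+u\<in>{F a..F b}. \<rho> (\<gamma> (?G u)) \<partial>lborel)"
    proof (rule nn_integral_stieltjes)
      show "mono_on {a..b} F" using r by (auto simp: mono_on_def F intro!: mult_left_mono)
      show "continuous_on {a..b} F"
        by (subst continuous_on_cong[OF refl F]) (auto intro!: continuous_intros)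
      fix u assume u: "u \<in> {F a..F b}"
      then have "u \<in> {0..(R - r) * (b - a)}" using F[of a] F[of b] ab by simp
      then have "?G u \<in> {a..b}" using r ab by (auto simp: field_simps)
      then show "?G u \<in> {a..b} \<and> F (?G u) = u" using r by (simp add: F)
    qed (use ab r F in \<open>auto intro!: continuous_intros simp: field_simps\<close>)
    also have "\<dots> = (\<integral>\<^sup>+u. \<rho> (\<gamma> (?G u)) * indicator {0..(R - r) * (b - a)} u \<partial>lborel)"
      using F[of a] F[of b] ab by simp
    \<comment> \<open>Here \<open>u\<close> is the arc length from \<open>\<gamma> a\<close>, a
      point of modulus \<open>r + a * (R - r)\<close>; the shift makes the modulus \<open>s\<close>
      the variable.\<close>
    also have "\<dots> = (\<integral>\<^sup>+s. \<rho> (\<gamma> (?G (- (r + a * (R - r)) + 1 * s))) * indicator {0..(R - r) * (b - a)} (- (r + a * (R - r)) + 1 * s) \<partial>lborel)"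
      by (subst nn_integral_real_affine[where c = 1 and t = "- (r + a * (R - r))"]) simp_all
    also have "\<dots> \<le> (\<integral>\<^sup>+s\<in>{r<..<R}. \<rho> (of_real s * c) \<partial>lborel)"
    proof (rule nn_integral_mono)
      fix s
      have "(- (r + a * (R - r)) + 1 * s) \<in> {0..(R - r) * (b - a)} \<Longrightarrow> s \<in> {r<..<R}"
      proof -
        assume *: "(- (r + a * (R - r)) + 1 * s) \<in> {0..(R - r) * (b - a)}"
        have "a * (R - r) > 0" "b * (R - r) < 1 * (R - r)" using ab r by (auto intro!: mult_strict_right_mono simp del: mult_1)
        with * show "s \<in> {r<..<R}" by (auto simp: algebra_simps)
      qed
      moreover have "\<gamma> (?G (- (r + a * (R - r)) + 1 * s)) = of_real s * c"
      proof -
        have "r + ?G (- (r + a * (R - r)) + 1 * s) * (R - r) = s" using r by (simp add: field_simps)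
        then show ?thesis unfolding \<gamma> by simp
      qed
      ultimately show "\<rho> (\<gamma> (?G (- (r + a * (R - r)) + 1 * s))) * indicator {0..(R - r) * (b - a)} (- (r + a * (R - r)) + 1 * s)
         \<le> \<rho> (of_real s * c) * indicator {r<..<R} s"
        by (simp only:) (auto split: split_indicator)
    qed
    finally show "(\<integral>\<^sup>+t\<in>{a..b}. \<rho> (\<gamma> t) \<partial>stieltjes_measure (\<lambda>s. enn2real (arc_length \<gamma> a s)) a b) \<le>
       (\<integral>\<^sup>+s\<in>{r<..<R}. \<rho> (of_real s * c) \<partial>lborel)" unfolding F_def .
  qed
qed

text \<open>This is Cauchy-Schwarz on each ray: the radial segments are joining curves, so
  \<open>\<rho>\<close> has integral at least 1 on each of them, and integrating over the angle
  gives the factor \<open>2 * pi\<close>.\<close>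

lemma weighted_modulus_radial_ge:
  fixes k :: "real \<Rightarrow> real"
  assumes r: "0 < r" "r < R" and [measurable]: "k \<in> borel_measurable borel"
    and k: "\<And>s. r < s \<Longrightarrow> s < R \<Longrightarrow> 0 < k s"
    and L: "0 < L" "(\<integral>\<^sup>+s\<in>{r<..<R}. ennreal (1 / (s * k s)) \<partial>lborel) \<le> ennreal L"
  shows "ennreal (2 * pi / L) \<le>
    weighted_modulus (\<lambda>z. ennreal (k (cmod z)) * indicator (annulus r R) z) (joining_curves r R)"
  unfolding weighted_modulus_def
proof (rule INF_greatest, clarify)
  fix \<rho> assume adm: "admissible \<rho> (joining_curves r R)"
  then have [measurable]: "\<rho> \<in> borel_measurable borel" by (simp add: admissible_def)
  have [measurable]: "annulus r R \<in> sets borel" unfolding annulus_def by measurable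
  have ray: "ennreal (1 / L) \<le> (\<integral>\<^sup>+s\<in>{r<..<R}. (\<rho> (of_real s * c))\<^sup>2 * ennreal (k s) * ennreal s \<partial>lborel)"
    (is "_ \<le> ?X") if c: "cmod c = 1" for c
  proof -
    define \<gamma> where "\<gamma> = (\<lambda>t. of_real r * c + of_real t * (of_real (R - r) * c))"
    have "1 \<le> curve_integral \<rho> \<gamma>"
      using adm radial_segment_joining[OF r c] radial_segment_rectifiable[OF r c]
      unfolding admissible_def \<gamma>_def by blast
    also have "\<dots> \<le> (\<integral>\<^sup>+s\<in>{r<..<R}. \<rho> (of_real s * c) \<partial>lborel)"
      unfolding \<gamma>_def by (rule curve_integral_radial_segment_le[OF r c]) simp
    finally have one: "1 \<le> (\<integral>\<^sup>+s\<in>{r<..<R}. \<rho> (of_real s * c) \<partial>lborel)" .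
    \<comment> \<open>Cauchy-Schwarz is used in its linearized form, obtained by expanding the
      square of \<open>x * q * L - 1\<close>. No roots of possibly infinite integrals occur; where
      \<open>\<rho>\<close> is infinite the right side is infinite too.\<close>
    have amgm: "ennreal (2 / L) * \<rho> (of_real s * c) \<le>
        (\<rho> (of_real s * c))\<^sup>2 * ennreal (k s) * ennreal s + ennreal (1 / L\<^sup>2) * ennreal (1 / (s * k s))"
      if s: "r < s" "s < R" for s
    proof (cases "\<rho> (of_real s * c)")
      case (real x)
      define q where "q = s * k s"
      have q: "q > 0" "k s > 0" "s > 0" using r s k[of s] by (auto simp: q_def)
      have "0 \<le> (x * q * L - 1)\<^sup>2 / (L\<^sup>2 * q)" using q by simp
      also have "\<dots> = x\<^sup>2 * q + 1 / (L\<^sup>2 * q) - 2 / L * x"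
        using q L by (simp add: field_simps power2_eq_square)
      finally have "2 / L * x \<le> x\<^sup>2 * k s * s + 1 / L\<^sup>2 * (1 / (s * k s))"
        by (simp add: q_def ac_simps)
      then show ?thesis using real q L
        by (simp add: ennreal_power flip: ennreal_mult ennreal_plus)
    next
      case top
      have "s > 0" "k s > 0" using r s k[of s] by auto
      then show ?thesis by (simp add: top power2_eq_square ennreal_top_mult)
    qed
    have "ennreal (2 / L) * 1 \<le> ennreal (2 / L) * (\<integral>\<^sup>+s\<in>{r<..<R}. \<rho> (of_real s * c) \<partial>lborel)"
      by (intro mult_left_mono one) simp
    also have "\<dots> = (\<integral>\<^sup>+s. ennreal (2 / L) * (\<rho> (of_real s * c) * indicator {r<..<R} s) \<partial>lborel)"
      by (rule nn_integral_cmult[symmetric]) simp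
    also have "\<dots> \<le> (\<integral>\<^sup>+s. (\<rho> (of_real s * c))\<^sup>2 * ennreal (k s) * ennreal s * indicator {r<..<R} s +
        ennreal (1 / L\<^sup>2) * (ennreal (1 / (s * k s)) * indicator {r<..<R} s) \<partial>lborel)"
      using amgm by (intro nn_integral_mono) (auto split: split_indicator)
    also have "\<dots> = ?X + ennreal (1 / L\<^sup>2) * (\<integral>\<^sup>+s\<in>{r<..<R}. ennreal (1 / (s * k s)) \<partial>lborel)"
      by (subst nn_integral_add) (simp_all add: nn_integral_cmult)
    also have "\<dots> \<le> ?X + ennreal (1 / L\<^sup>2) * ennreal L"
      by (intro add_left_mono mult_left_mono L) simp
    also have "ennreal (1 / L\<^sup>2) * ennreal L = ennreal (1 / L)"
      using L by (simp add: power2_eq_square flip: ennreal_mult)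
    \<comment> \<open>\<open>2 / L\<close> is split so that the finite term \<open>1 / L\<close>
      cancels.\<close>
    finally have "ennreal (1 / L) + ennreal (1 / L) \<le> ennreal (1 / L) + ?X"
      using L by (simp add: add.commute flip: ennreal_plus)
    then show ?thesis by (simp add: ennreal_add_left_cancel_le)
  qed
  have four: "(\<Sum>j<(4::nat). \<integral>\<^sup>+\<theta>\<in>{-pi/4..pi/4}. ennreal (1 / L) \<partial>lborel) = ennreal (2 * pi / L)"
    using L by (simp add: nn_integral_cmult flip: ennreal_mult ennreal_numeral)
  have "ennreal (2 * pi / L) = (\<Sum>j<(4::nat). \<integral>\<^sup>+\<theta>\<in>{-pi/4..pi/4}. ennreal (1 / L) \<partial>lborel)"
    by (rule four[symmetric])
  also have "\<dots> \<le> (\<Sum>j<4. \<integral>\<^sup>+\<theta>\<in>{-pi/4..pi/4}. \<integral>\<^sup>+s\<in>{0<..}. (\<rho> (\<i> ^ j * (of_real s * cis \<theta>)))\<^sup>2 *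
      (ennreal (k (cmod (\<i> ^ j * (of_real s * cis \<theta>)))) * indicator (annulus r R) (\<i> ^ j * (of_real s * cis \<theta>))) * ennreal s \<partial>lborel \<partial>lborel)"
  proof (intro sum_mono nn_integral_mono mult_right_mono)
    fix j :: nat and \<theta> :: real
    have "cmod (\<i> ^ j * cis \<theta>) = 1" by (simp add: norm_mult norm_power)
    note ray[OF this]
    also have "(\<integral>\<^sup>+s\<in>{r<..<R}. (\<rho> (of_real s * (\<i> ^ j * cis \<theta>)))\<^sup>2 * ennreal (k s) * ennreal s \<partial>lborel) =
      (\<integral>\<^sup>+s\<in>{0<..}. (\<rho> (\<i> ^ j * (of_real s * cis \<theta>)))\<^sup>2 *
      (ennreal (k (cmod (\<i> ^ j * (of_real s * cis \<theta>)))) * indicator (annulus r R) (\<i> ^ j * (of_real s * cis \<theta>))) * ennreal s \<partial>lborel)"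
    proof (rule nn_integral_cong)
      fix s :: real
      have e: "\<i> ^ j * (of_real s * cis \<theta>) = of_real s * (\<i> ^ j * cis \<theta>)" by simp
      have n: "cmod (of_real s * (\<i> ^ j * cis \<theta>)) = \<bar>s\<bar>" by (simp add: norm_mult norm_power)
      show "(\<rho> (of_real s * (\<i> ^ j * cis \<theta>)))\<^sup>2 * ennreal (k s) * ennreal s * indicator {r<..<R} s =
        (\<rho> (\<i> ^ j * (of_real s * cis \<theta>)))\<^sup>2 * (ennreal (k (cmod (\<i> ^ j * (of_real s * cis \<theta>)))) *
          indicator (annulus r R) (\<i> ^ j * (of_real s * cis \<theta>))) * ennreal s * indicator {0<..} s"
        unfolding e n using r n
        by (cases "s \<in> {r<..<R}") (auto simp: annulus_def mult.assoc split: split_indicator)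
    qed
    finally show "ennreal (1 / L) \<le> \<dots>" .
  qed simp
  also have "\<dots> = (\<integral>\<^sup>+z. (\<rho> z)\<^sup>2 * (ennreal (k (cmod z)) * indicator (annulus r R) z) \<partial>lborel)"
    by (rule nn_integral_polar[symmetric]) simp
  also have "\<dots> = (\<integral>\<^sup>+z. (\<rho> z)\<^sup>2 * (ennreal (k (cmod z)) * indicator (annulus r R) z) \<partial>lebesgue)"
    by (simp add: nn_integral_completion)
  finally show "ennreal (2 * pi / L) \<le> (\<integral>\<^sup>+z. (\<rho> z)\<^sup>2 * (ennreal (k (cmod z)) * indicator (annulus r R) z) \<partial>lebesgue)" .
qed

section \<open>Asymptotics of the conditional modulus\<close>

locale modulus_weight =
  fixes \<psi> \<phi> :: "real \<Rightarrow> real"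
  assumes strict: "strict_mono_on {1..} \<psi>" and conv: "convex_on {1..} \<psi>"
    and hom: "homeomorphism {1..} {0..} \<psi> \<phi>"
begin

lemma inverse_psi: "1 \<le> x \<Longrightarrow> \<phi> (\<psi> x) = x" and inverse_phi: "0 \<le> y \<Longrightarrow> \<psi> (\<phi> y) = y"
  and phi_ge_1: "0 \<le> y \<Longrightarrow> 1 \<le> \<phi> y" and psi_nonneg: "1 \<le> x \<Longrightarrow> 0 \<le> \<psi> x"
  and psi_cont: "continuous_on {1..} \<psi>" and phi_cont: "continuous_on {0..} \<phi>"
  using hom by (force simp: homeomorphism_def)+

lemma psi_mono: "1 \<le> x \<Longrightarrow> x \<le> y \<Longrightarrow> \<psi> x \<le> \<psi> y"
  by (rule mono_onD[OF strict_mono_on_imp_mono_on[OF strict]]) auto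

lemma psi_less_iff: "1 \<le> x \<Longrightarrow> 1 \<le> y \<Longrightarrow> \<psi> x < \<psi> y \<longleftrightarrow> x < y"
  by (meson atLeast_iff linorder_not_less psi_mono strict strict_mono_onD)

text \<open>The value 0 is attained at \<open>\<phi> 0 >= 1\<close>, and by monotonicity
  \<open>\<psi> 1\<close> cannot be larger.\<close>

lemma psi_1: "\<psi> 1 = 0"
  using psi_mono[of 1 "\<phi> 0"] psi_nonneg[of 1] phi_ge_1[of 0] inverse_phi[of 0] by simp

lemma le_phi_iff: "1 \<le> x \<Longrightarrow> 0 \<le> y \<Longrightarrow> x \<le> \<phi> y \<longleftrightarrow> \<psi> x \<le> y"
  using psi_less_iff[of "\<phi> y" x] phi_ge_1[of y] inverse_phi[of y] by auto

lemma phi_le_iff: "1 \<le> x \<Longrightarrow> 0 \<le> y \<Longrightarrow> \<phi> y \<le> x \<longleftrightarrow> y \<le> \<psi> x"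
  using psi_less_iff[of x "\<phi> y"] phi_ge_1[of y] inverse_phi[of y] by auto

lemma phi_mono: "0 \<le> x \<Longrightarrow> x \<le> y \<Longrightarrow> \<phi> x \<le> \<phi> y"
  by (subst phi_le_iff) (auto simp: inverse_phi phi_ge_1)

text \<open>Nothing is known about \<open>\<phi>\<close> on negative numbers, hence the
  clamping.\<close>

lemma phi_measurable: "(\<lambda>y. \<phi> (max 0 y)) \<in> borel_measurable borel"
  by (intro borel_measurable_continuous_onI continuous_on_compose2[OF phi_cont])
    (auto intro!: continuous_intros)

lemma psi_measurable: "(\<lambda>x. \<psi> (max 1 x)) \<in> borel_measurable borel"
  by (intro borel_measurable_continuous_onI continuous_on_compose2[OF psi_cont])
    (auto intro!: continuous_intros)

lemma phi_compose_measurable: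
  assumes [measurable]: "h \<in> borel_measurable M" and "\<And>x. 0 \<le> h x"
  shows "(\<lambda>x. \<phi> (h x)) \<in> borel_measurable M"
proof -
  have "(\<lambda>x. \<phi> (max 0 (h x))) \<in> borel_measurable M"
    using measurable_compose[OF assms(1) phi_measurable] by simp
  then show ?thesis using assms(2) by (simp add: max_absorb2)
qed

text \<open>Since \<open>ln (\<psi> (k0 s)) = 2 * ln (1 / s)\<close> for positive \<open>s\<close>,
  the limits of integration in the theorem are \<open>k0 R\<close> and \<open>k0 r\<close>. The
  convention \<open>1 / 0 = 0\<close> gives \<open>k0 0 = \<phi> 0\<close>, so bounds such as
  \<open>k0_ge_1\<close> hold for all \<open>s\<close>.\<close>

definition k0 :: "real \<Rightarrow> real" where "k0 s = \<phi> (1 / s\<^sup>2)"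

lemma k0_ge_1: "1 \<le> k0 s"
  by (simp add: k0_def phi_ge_1)

lemma psi_k0: "\<psi> (k0 s) = 1 / s\<^sup>2"
  by (simp add: k0_def inverse_phi)

lemma k0_gt_1: "s \<noteq> 0 \<Longrightarrow> 1 < k0 s"
  using psi_k0[of s] psi_1 k0_ge_1[of s] by (cases "k0 s = 1") auto

lemma k0_measurable[measurable]: "k0 \<in> borel_measurable borel"
proof -
  have "(\<lambda>s. \<phi> (1 / s\<^sup>2)) \<in> borel_measurable borel" by (intro phi_compose_measurable) auto
  then show ?thesis by (simp add: k0_def[abs_def])
qed

lemma k0_cont: "0 < r \<Longrightarrow> continuous_on {r..R} k0"
  unfolding k0_def[abs_def]
  by (rule continuous_on_compose2[OF phi_cont]) (auto intro!: continuous_intros)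

lemma k0_antimono: "0 < s \<Longrightarrow> s \<le> t \<Longrightarrow> k0 t \<le> k0 s"
  unfolding k0_def by (intro phi_mono) (auto intro!: divide_left_mono power_mono)

text \<open>
  Above \<open>k0 s\<close> the chord from \<open>(1, 0)\<close> has slope at least \<open>\<psi> (k0 s) / (k0 s - 1)\<close>.
\<close>
lemma weight_le:
  assumes s: "0 < s" and K: "1 \<le> K"
  shows "K \<le> k0 s + k0 s * s\<^sup>2 * \<psi> K"
proof (cases "K \<le> k0 s")
  case True
  have "0 \<le> k0 s * s\<^sup>2 * \<psi> K" using k0_ge_1[of s] psi_nonneg[OF K] by simp
  then show ?thesis using True by linarith
next
  case False
  define k where "k = k0 s"
  have k: "1 < k" "k < K" using False k0_gt_1[of s] s by (auto simp: k_def)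
  define t where "t = (k - 1) / (K - 1)"
  have t: "0 \<le> t" "t \<le> 1" using k by (auto simp: t_def)
  have "t * (K - 1) = k - 1" using k by (simp add: t_def)
  then have "k = 1 + t * (K - 1)" by simp
  also have "\<dots> = (1 - t) *\<^sub>R 1 + t *\<^sub>R K" by (simp add: algebra_simps)
  finally have "k = (1 - t) *\<^sub>R 1 + t *\<^sub>R K" .
  then have "\<psi> k \<le> (1 - t) * \<psi> 1 + t * \<psi> K"
    using convex_onD[OF conv t, of 1 K] K by simp
  then have "1 / s\<^sup>2 \<le> (k - 1) / (K - 1) * \<psi> K"
    using psi_k0[of s] by (simp add: psi_1 t_def k_def)
  then have "K - 1 \<le> (k - 1) * s\<^sup>2 * \<psi> K"
    using k s by (simp add: field_simps)
  also have "\<dots> \<le> k * s\<^sup>2 * \<psi> K"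
    using psi_nonneg[OF K] by (intro mult_right_mono) auto
  finally show ?thesis using k by (simp add: k_def)
qed

section \<open>The comparison integral and the upper bound for the modulus\<close>

definition J :: "real \<Rightarrow> real \<Rightarrow> real" where
  "J r R = integral {r..R} (\<lambda>s. 1 / (s * k0 s))"

lemma J_integrand_cont:
  assumes "0 < r" shows "continuous_on {r..R} (\<lambda>s. 1 / (s * k0 s))"
proof -
  have "k0 s \<noteq> 0" for s using k0_ge_1[of s] by linarith
  then show ?thesis using assms by (intro continuous_intros k0_cont) auto
qed

lemma nn_integral_J:
  assumes "0 < r"
  shows "(\<integral>\<^sup>+s\<in>{r..R}. ennreal (1 / (s * k0 s)) \<partial>lborel) = ennreal (J r R)"
proof -
  have nn: "0 \<le> 1 / (s * k0 s)" if "s \<in> {r..R}" for s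
    using assms that k0_ge_1[of s] by auto
  have "(\<integral>\<^sup>+s. ennreal (indicator {r..R} s * (1 / (s * k0 s))) \<partial>lborel) = ennreal (J r R)"
    unfolding J_def using nn
    by (intro nn_integral_has_integral_lebesgue integrable_integral integrable_continuous_real J_integrand_cont assms)
  then show ?thesis
    by (subst (asm) nn_integral_cong[where v="\<lambda>s. ennreal (1 / (s * k0 s)) * indicator {r..R} s"])
      (auto split: split_indicator)
qed

lemma J_pos:
  assumes "0 < r" "r < R"
  shows "0 < J r R"
proof -
  have "integral {r..R} (\<lambda>s. 1 / (R * k0 r)) \<le> J r R"
    unfolding J_def
  proof (rule integral_le)
    fix s assume s: "s \<in> {r..R}"
    then show "1 / (R * k0 r) \<le> 1 / (s * k0 s)"
      using assms k0_ge_1[of s] k0_antimono[of r s]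
      by (intro divide_left_mono mult_mono mult_pos_pos) auto
  qed (intro integrable_continuous_real J_integrand_cont continuous_intros assms)+
  moreover have "0 < (R - r) * (1 / (R * k0 r))"
    using assms k0_ge_1[of r] by (intro mult_pos_pos divide_pos_pos) auto
  ultimately show ?thesis using assms by simp
qed

text \<open>In the bound of \<open>weight_le\<close>, the term \<open>k0 s\<close> contributes
  \<open>2 * pi / J\<close> to the energy of the test metric. In the other term the squared metric
  cancels \<open>s^2\<close> and one factor \<open>k0 s\<close>, leaving
  \<open>\<psi> K / (k0 s * J^2)\<close>. As \<open>k0\<close> decreases in \<open>s\<close>, this
  is controlled by the budget \<open>I\<close> and \<open>k0 R\<close>.\<close>

lemma conditional_modulus_le:
  assumes r: "0 < r" "r < R" and I: "0 < I"
  shows "conditional_modulus \<psi> I (annulus r R) (joining_curves r R) \<le>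
    ennreal ((2 * pi * J r R + I / k0 R) / (J r R)\<^sup>2)"
  unfolding conditional_modulus_def
proof (rule SUP_least, clarify)
  let ?A = "annulus r R"
  fix K :: "complex \<Rightarrow> real"
  assume Km: "K \<in> borel_measurable (lebesgue_on ?A)" and K1: "\<forall>z\<in>?A. 1 \<le> K z"
    and KI: "(\<integral>\<^sup>+z\<in>?A. ennreal (\<psi> (K z)) \<partial>lebesgue) \<le> ennreal I"
  have Ab[measurable]: "?A \<in> sets borel" unfolding annulus_def by measurable
  have [measurable]: "?A \<in> sets lebesgue" using sets_completionI_sets[of ?A lborel] by simp
  \<comment> \<open>\<open>K\<close> is measurable only on the annulus and \<open>\<psi>\<close> is
    controlled only on \<open>[1, \<infinity>)\<close>, so \<open>K\<close> is extended by zero and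
    then clamped at 1.\<close>
  have psiK[measurable]: "(\<lambda>z. ennreal (\<psi> (K z)) * indicator ?A z) \<in> borel_measurable lebesgue"
  proof -
    have "(\<lambda>z. if z \<in> ?A then K z else 0) \<in> borel_measurable lebesgue"
      using Km by (rule borel_measurable_if_I) simp
    then have [measurable]: "(\<lambda>z. \<psi> (max 1 (if z \<in> ?A then K z else 0))) \<in> borel_measurable lebesgue"
      by (rule measurable_compose[OF _ psi_measurable])
    have "(\<lambda>z. ennreal (\<psi> (K z)) * indicator ?A z) =
        (\<lambda>z. ennreal (\<psi> (max 1 (if z \<in> ?A then K z else 0))) * indicator ?A z)"
      using K1 by (auto split: split_indicator simp: max_absorb2)
    also have "\<dots> \<in> borel_measurable lebesgue" by simp
    finally show ?thesis .
  qed
  define j where "j = J r R"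
  have j: "0 < j" using J_pos r by (simp add: j_def)
  \<comment> \<open>Equality in Cauchy-Schwarz for the weight \<open>k0\<close> forces a metric
    proportional to \<open>1 / (s * k0 s)\<close>; dividing by \<open>j\<close> normalizes its
    radial integral to 1.\<close>
  define f where "f s = 1 / (s * k0 s) / j" for s
  have kp: "0 < k0 s" for s using k0_ge_1[of s] by linarith
  have f_nonneg: "0 \<le> f s" if "r \<le> s" for s using that r j kp[of s] by (simp add: f_def)
  have adm: "admissible (\<lambda>z. ennreal (f (cmod z)) * indicator ?A z) (joining_curves r R)"
  proof (rule admissible_radial[OF r])
    show "continuous_on {r..R} f"
      unfolding f_def using j by (intro continuous_on_divide J_integrand_cont continuous_on_const) (auto simp: r)
    have "integral {r..R} f = 1"
      unfolding f_def integral_divide using j by (simp add: J_def[symmetric] j_def)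
    then show "1 \<le> integral {r..R} f" by simp
  qed (use f_nonneg in auto)
  have A: "(\<integral>\<^sup>+z. ennreal (1 / ((cmod z)\<^sup>2 * k0 (cmod z) * j\<^sup>2)) * indicator {r<..<R} (cmod z) \<partial>lebesgue) \<le>
      ennreal (2 * pi / j)"
  proof -
    have "(\<integral>\<^sup>+s\<in>{0<..}. ennreal (1 / (s\<^sup>2 * k0 s * j\<^sup>2)) * indicator {r<..<R} s * ennreal s \<partial>lborel) \<le>
        (\<integral>\<^sup>+s. ennreal (1 / j\<^sup>2) * (ennreal (1 / (s * k0 s)) * indicator {r..R} s) \<partial>lborel)"
    proof (rule nn_integral_mono)
      fix s
      show "ennreal (1 / (s\<^sup>2 * k0 s * j\<^sup>2)) * indicator {r<..<R} s * ennreal s * indicator {0<..} s \<le>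
        ennreal (1 / j\<^sup>2) * (ennreal (1 / (s * k0 s)) * indicator {r..R} s)"
      proof (cases "s \<in> {r<..<R}")
        case True
        then have "1 / (s\<^sup>2 * k0 s * j\<^sup>2) * s = 1 / j\<^sup>2 * (1 / (s * k0 s))"
          using r kp[of s] by (simp add: power2_eq_square)
        then have "ennreal (1 / (s\<^sup>2 * k0 s * j\<^sup>2)) * ennreal s = ennreal (1 / j\<^sup>2) * ennreal (1 / (s * k0 s))"
          using True r kp[of s] by (simp flip: ennreal_mult)
        then show ?thesis using True by (auto split: split_indicator)
      qed simp
    qed
    also have "\<dots> = ennreal (1 / j\<^sup>2) * (\<integral>\<^sup>+s\<in>{r..R}. ennreal (1 / (s * k0 s)) \<partial>lborel)"
      by (rule nn_integral_cmult) simp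
    also have "\<dots> = ennreal (1 / j\<^sup>2) * ennreal j"
      unfolding nn_integral_J[OF r(1)] j_def ..
    finally have inner: "(\<integral>\<^sup>+s\<in>{0<..}. ennreal (1 / (s\<^sup>2 * k0 s * j\<^sup>2)) * indicator {r<..<R} s * ennreal s \<partial>lborel) \<le>
        ennreal (1 / j\<^sup>2) * ennreal j" .
    have "(\<integral>\<^sup>+z. ennreal (1 / ((cmod z)\<^sup>2 * k0 (cmod z) * j\<^sup>2)) * indicator {r<..<R} (cmod z) \<partial>lebesgue) =
        ennreal (2 * pi) * (\<integral>\<^sup>+s\<in>{0<..}. ennreal (1 / (s\<^sup>2 * k0 s * j\<^sup>2)) * indicator {r<..<R} s * ennreal s \<partial>lborel)"
      unfolding nn_integral_completion by (rule nn_integral_radial) measurable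
    also have "\<dots> \<le> ennreal (2 * pi) * (ennreal (1 / j\<^sup>2) * ennreal j)"
      by (rule mult_left_mono[OF inner]) simp
    also have "\<dots> = ennreal (2 * pi / j)"
      using j by (simp add: power2_eq_square flip: ennreal_mult)
    finally show ?thesis .
  qed
  have B: "(\<integral>\<^sup>+z. ennreal (1 / (k0 R * j\<^sup>2)) * (ennreal (\<psi> (K z)) * indicator ?A z) \<partial>lebesgue) \<le>
      ennreal (1 / (k0 R * j\<^sup>2)) * ennreal I"
    by (subst nn_integral_cmult) (auto intro!: mult_left_mono KI)
  from adm have "weighted_modulus (\<lambda>z. ennreal (K z) * indicator ?A z) (joining_curves r R) \<le>
      (\<integral>\<^sup>+z. (ennreal (f (cmod z)) * indicator ?A z)\<^sup>2 * (ennreal (K z) * indicator ?A z) \<partial>lebesgue)"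
    unfolding weighted_modulus_def by (intro INF_lower) simp
  also have "\<dots> \<le> (\<integral>\<^sup>+z. ennreal (1 / ((cmod z)\<^sup>2 * k0 (cmod z) * j\<^sup>2)) * indicator {r<..<R} (cmod z) +
      ennreal (1 / (k0 R * j\<^sup>2)) * (ennreal (\<psi> (K z)) * indicator ?A z) \<partial>lebesgue)"
  proof (rule nn_integral_mono)
    fix z
    show "(ennreal (f (cmod z)) * indicator ?A z)\<^sup>2 * (ennreal (K z) * indicator ?A z) \<le>
      ennreal (1 / ((cmod z)\<^sup>2 * k0 (cmod z) * j\<^sup>2)) * indicator {r<..<R} (cmod z) +
      ennreal (1 / (k0 R * j\<^sup>2)) * (ennreal (\<psi> (K z)) * indicator ?A z)"
    proof (cases "z \<in> ?A")
      case True
      define s where "s = cmod z"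
      have s: "r < s" "s < R" "0 < s" using True r by (auto simp: annulus_def s_def)
      have Kz: "1 \<le> K z" using K1 True by blast
      have "(f s)\<^sup>2 * K z \<le> (f s)\<^sup>2 * (k0 s + k0 s * s\<^sup>2 * \<psi> (K z))"
        by (intro mult_left_mono weight_le s Kz) simp
      also have "\<dots> = 1 / (s\<^sup>2 * k0 s * j\<^sup>2) + 1 / (k0 s * j\<^sup>2) * \<psi> (K z)"
        using s j kp[of s] by (simp add: f_def field_simps power2_eq_square)
      also have "\<dots> \<le> 1 / (s\<^sup>2 * k0 s * j\<^sup>2) + 1 / (k0 R * j\<^sup>2) * \<psi> (K z)"
        using s j kp k0_antimono[of s R] psi_nonneg[OF Kz]
        by (intro add_left_mono mult_right_mono divide_left_mono mult_right_mono) auto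
      finally have "ennreal ((f s)\<^sup>2 * K z) \<le> ennreal (1 / (s\<^sup>2 * k0 s * j\<^sup>2) + 1 / (k0 R * j\<^sup>2) * \<psi> (K z))"
        by (rule ennreal_leI)
      moreover have "ennreal ((f s)\<^sup>2 * K z) = (ennreal (f s))\<^sup>2 * ennreal (K z)"
        using Kz f_nonneg[of s] s by (simp add: ennreal_mult ennreal_power)
      moreover have e: "ennreal (1 / (k0 R * j\<^sup>2)) * ennreal (\<psi> (K z)) = ennreal (1 / (k0 R * j\<^sup>2) * \<psi> (K z))"
        using kp[of R] psi_nonneg[OF Kz] by (intro ennreal_mult[symmetric]) auto
      moreover have "ennreal (1 / (s\<^sup>2 * k0 s * j\<^sup>2) + 1 / (k0 R * j\<^sup>2) * \<psi> (K z)) =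
          ennreal (1 / (s\<^sup>2 * k0 s * j\<^sup>2)) + ennreal (1 / (k0 R * j\<^sup>2)) * ennreal (\<psi> (K z))"
        unfolding e using s kp[of s] kp[of R] psi_nonneg[OF Kz] by (intro ennreal_plus) auto
      ultimately show ?thesis using True s by (simp add: s_def)
    qed simp
  qed
  also have "\<dots> = (\<integral>\<^sup>+z. ennreal (1 / ((cmod z)\<^sup>2 * k0 (cmod z) * j\<^sup>2)) * indicator {r<..<R} (cmod z) \<partial>lebesgue) +
      (\<integral>\<^sup>+z. ennreal (1 / (k0 R * j\<^sup>2)) * (ennreal (\<psi> (K z)) * indicator ?A z) \<partial>lebesgue)"
  proof (rule nn_integral_add)
    have "(\<lambda>z. ennreal (1 / ((cmod z)\<^sup>2 * k0 (cmod z) * j\<^sup>2)) * indicator {r<..<R} (cmod z)) \<in> borel_measurable lborel"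
      by measurable
    then show "(\<lambda>z. ennreal (1 / ((cmod z)\<^sup>2 * k0 (cmod z) * j\<^sup>2)) * indicator {r<..<R} (cmod z)) \<in> borel_measurable lebesgue"
      by (rule measurable_completion)
    show "(\<lambda>z. ennreal (1 / (k0 R * j\<^sup>2)) * (ennreal (\<psi> (K z)) * indicator ?A z)) \<in> borel_measurable lebesgue"
      by simp
  qed
  also have "\<dots> \<le> ennreal (2 * pi / j) + ennreal (1 / (k0 R * j\<^sup>2)) * ennreal I"
    by (rule add_mono[OF A B])
  also have "ennreal (2 * pi / j) + ennreal (1 / (k0 R * j\<^sup>2)) * ennreal I = ennreal ((2 * pi * j + I / k0 R) / j\<^sup>2)"
    using j kp[of R] I by (simp add: add_divide_distrib power2_eq_square mult.commute flip: ennreal_mult ennreal_plus)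
  finally show "weighted_modulus (\<lambda>z. ennreal (K z) * indicator ?A z) (joining_curves r R) \<le>
      ennreal ((2 * pi * J r R + I / k0 R) / (J r R)\<^sup>2)"
    by (simp add: j_def)
qed

section \<open>Feasible radial weights and the lower bound for the modulus\<close>

text \<open>
  The logarithmic factor makes \<open>\<psi> (k1 \<bar>z\<bar>)\<close> integrable at the origin, which \<open>\<psi> (k0 \<bar>z\<bar>)\<close> just fails to be.
\<close>
definition k1 :: "real \<Rightarrow> real" where "k1 s = \<phi> (1 / (s * ln s)\<^sup>2)"

lemma k1_ge_1: "1 \<le> k1 s"
  by (simp add: k1_def phi_ge_1)

lemma psi_k1: "\<psi> (k1 s) = 1 / (s * ln s)\<^sup>2"
  by (simp add: k1_def inverse_phi)

lemma k1_measurable[measurable]: "k1 \<in> borel_measurable borel"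
proof -
  have "(\<lambda>s. \<phi> (1 / (s * ln s)\<^sup>2)) \<in> borel_measurable borel" by (intro phi_compose_measurable) auto
  then show ?thesis by (simp add: k1_def[abs_def])
qed

lemma weighted_modulus_le_conditional:
  assumes [measurable]: "k \<in> borel_measurable borel" and k: "\<And>s. 1 \<le> k s"
    and int: "(\<integral>\<^sup>+z\<in>annulus r R. ennreal (\<psi> (k (cmod z))) \<partial>lebesgue) \<le> ennreal I"
  shows "weighted_modulus (\<lambda>z. ennreal (k (cmod z)) * indicator (annulus r R) z) \<Gamma> \<le>
    conditional_modulus \<psi> I (annulus r R) \<Gamma>"
  unfolding conditional_modulus_def
proof (rule SUP_upper, intro CollectI conjI ballI)
  have "(\<lambda>z::complex. k (cmod z)) \<in> borel_measurable lborel" by measurable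
  then have "(\<lambda>z::complex. k (cmod z)) \<in> borel_measurable lebesgue" by (rule measurable_completion)
  then show "(\<lambda>z. k (cmod z)) \<in> borel_measurable (lebesgue_on (annulus r R))"
    by (rule measurable_restrict_space1)
qed (use k int in auto)

text \<open>The constant weight 1 costs nothing because \<open>\<psi> 1 = 0\<close>. The resulting
  positivity of the modulus makes \<open>2 * pi / M\<close> finite for every \<open>R\<close>, also
  where the asymptotic bounds do not apply.\<close>

lemma conditional_modulus_ge_log:
  assumes r: "0 < r" "r < R"
  shows "ennreal (2 * pi / ln (R / r)) \<le> conditional_modulus \<psi> I (annulus r R) (joining_curves r R)"
proof -
  have lnpos: "0 < ln (R / r)" using r by simp
  have "ennreal (2 * pi / ln (R / r)) \<le>
      weighted_modulus (\<lambda>z. ennreal 1 * indicator (annulus r R) z) (joining_curves r R)"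
  proof (rule weighted_modulus_radial_ge[OF r])
    have "(\<integral>\<^sup>+s\<in>{r<..<R}. ennreal (1 / (s * 1)) \<partial>lborel) \<le> (\<integral>\<^sup>+s. ennreal (1 / s) * indicator {r..R} s \<partial>lborel)"
      by (intro nn_integral_mono) (auto split: split_indicator)
    also have "\<dots> = ennreal (ln R - ln r)"
      by (rule nn_integral_FTC_Icc) (use r in \<open>auto intro!: derivative_eq_intros\<close>)
    finally show "(\<integral>\<^sup>+s\<in>{r<..<R}. ennreal (1 / (s * 1)) \<partial>lborel) \<le> ennreal (ln (R / r))"
      using r by (simp add: ln_div)
  qed (use lnpos in auto)
  also have "\<dots> \<le> conditional_modulus \<psi> I (annulus r R) (joining_curves r R)"
    by (rule weighted_modulus_le_conditional) (auto simp: psi_1)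
  finally show ?thesis .
qed

lemma k1_feasible:
  assumes r: "0 < r" "r < R" "R < 1" and I: "2 * pi / ln (1 / R) \<le> I"
  shows "(\<integral>\<^sup>+z\<in>annulus r R. ennreal (\<psi> (k1 (cmod z))) \<partial>lebesgue) \<le> ennreal I"
proof -
  have ln_neg: "ln s < 0" if "0 < s" "s \<le> R" for s using that r by auto
  have "(\<integral>\<^sup>+z\<in>annulus r R. ennreal (\<psi> (k1 (cmod z))) \<partial>lebesgue) =
      (\<integral>\<^sup>+z. ennreal (1 / (cmod z * ln (cmod z))\<^sup>2) * indicator {r<..<R} (cmod z) \<partial>lborel)"
    unfolding nn_integral_completion
    by (intro nn_integral_cong) (auto simp: psi_k1 annulus_def split: split_indicator)
  also have "\<dots> = ennreal (2 * pi) * (\<integral>\<^sup>+s\<in>{0<..}. ennreal (1 / (s * ln s)\<^sup>2) * indicator {r<..<R} s * ennreal s \<partial>lborel)"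
    by (rule nn_integral_radial) measurable
  also have "\<dots> \<le> ennreal (2 * pi) * (\<integral>\<^sup>+s. ennreal (1 / (s * (ln s)\<^sup>2)) * indicator {r..R} s \<partial>lborel)"
  proof (intro mult_left_mono nn_integral_mono)
    fix s
    show "ennreal (1 / (s * ln s)\<^sup>2) * indicator {r<..<R} s * ennreal s * indicator {0<..} s \<le>
        ennreal (1 / (s * (ln s)\<^sup>2)) * indicator {r..R} s"
    proof (cases "s \<in> {r<..<R}")
      case True
      then have "1 / (s * ln s)\<^sup>2 * s = 1 / (s * (ln s)\<^sup>2)"
        using r by (simp add: power2_eq_square)
      then have "ennreal (1 / (s * ln s)\<^sup>2) * ennreal s = ennreal (1 / (s * (ln s)\<^sup>2))"
        using True r by (simp flip: ennreal_mult)
      then show ?thesis using True by (auto split: split_indicator)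
    qed simp
  qed simp
  also have "(\<integral>\<^sup>+s. ennreal (1 / (s * (ln s)\<^sup>2)) * indicator {r..R} s \<partial>lborel) = ennreal (- 1 / ln R - - 1 / ln r)"
  proof (rule nn_integral_FTC_Icc)
    fix x assume x: "x \<in> {r..R}"
    then have "0 < x" "ln x \<noteq> 0" using r ln_neg[of x] by auto
    then show "((\<lambda>x. - 1 / ln x) has_real_derivative 1 / (x * (ln x)\<^sup>2)) (at x)"
      by (auto intro!: derivative_eq_intros simp: power2_eq_square field_simps)
  qed (use r in auto)
  \<comment> \<open>The contribution of the inner radius has the favourable sign and is dropped,
    leaving a bound free of \<open>r\<close>.\<close>
  also have "ennreal (2 * pi) * \<dots> \<le> ennreal (2 * pi) * ennreal (1 / ln (1 / R))"
    using ln_neg[of r] ln_neg[of R] r by (intro mult_left_mono ennreal_leI) (auto simp: ln_div)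
  also have "\<dots> = ennreal (2 * pi / ln (1 / R))"
    using ln_neg[of R] r by (simp add: ln_div flip: ennreal_mult)
  also have "\<dots> \<le> ennreal I" by (rule ennreal_leI[OF I])
  finally show ?thesis .
qed

text \<open>
  With \<open>v = ln (\<psi> x)\<close> and \<open>\<sigma> = ln (1 / s)\<close> the condition says \<open>2 * \<sigma> - 2 * ln \<sigma> \<le> v \<le> 2 * \<sigma>\<close>,
  which confines \<open>\<sigma>\<close> to \<open>[v / 2, v / 2 + ln v]\<close>.
\<close>
lemma between_k1_k0:
  assumes s: "0 < s" "s < R" and R: "R \<le> exp (-2)" and x: "k1 s \<le> x" "x \<le> k0 s"
  defines "v \<equiv> ln (\<psi> x)"
  shows "\<phi> (1 / R) \<le> x" "1 \<le> v" "s \<in> {exp (- v / 2) / v..exp (- v / 2)}"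
proof -
  define \<sigma> where "\<sigma> = - ln s"
  have sR: "ln s < ln R" using s by simp
  moreover have "ln R \<le> - 2" using R s by (metis exp_gt_zero ln_exp ln_le_cancel_iff order.strict_trans)
  ultimately have \<sigma>: "2 < \<sigma>" "- ln R < \<sigma>" by (auto simp: \<sigma>_def)
  have s_eq: "s = exp (- \<sigma>)" using s by (simp add: \<sigma>_def)
  have x1: "1 \<le> x" using x k1_ge_1[of s] by linarith
  have lo: "1 / (s * ln s)\<^sup>2 \<le> \<psi> x" using psi_mono[OF k1_ge_1 x(1)] by (simp add: psi_k1)
  have hi: "\<psi> x \<le> 1 / s\<^sup>2" using psi_mono[OF x1 x(2)] by (simp add: psi_k0)
  have pos: "0 < 1 / (s * ln s)\<^sup>2" using s \<sigma> by (auto simp: \<sigma>_def)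
  have px: "0 < \<psi> x" using lo pos by linarith
  have "ln (1 / (s * ln s)\<^sup>2) \<le> v" unfolding v_def using lo pos px by (subst ln_le_cancel_iff) auto
  moreover have "1 / (s * ln s)\<^sup>2 = 1 / (s * \<sigma>)\<^sup>2" by (simp add: \<sigma>_def power2_eq_square)
  moreover have "ln (1 / (s * \<sigma>)\<^sup>2) = 2 * \<sigma> - 2 * ln \<sigma>"
    using s \<sigma> by (simp add: ln_div ln_realpow ln_mult) (simp add: \<sigma>_def)
  ultimately have v1: "2 * \<sigma> - 2 * ln \<sigma> \<le> v" by simp
  have "v \<le> ln (1 / s\<^sup>2)" unfolding v_def using hi px s by (subst ln_le_cancel_iff) auto
  then have v2: "v \<le> 2 * \<sigma>" using s by (simp add: ln_div ln_realpow \<sigma>_def)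
  \<comment> \<open>The tangent of \<open>ln\<close> at 2 and \<open>ln 2 < 1\<close> give
    \<open>ln \<sigma> <= \<sigma> / 2\<close>, so the lower bound
    \<open>2 * \<sigma> - 2 * ln \<sigma>\<close> for \<open>v\<close> is at least
    \<open>\<sigma>\<close>. With \<open>\<sigma> > 2\<close>, from \<open>R <= exp (-2)\<close>,
    this also makes \<open>ln v\<close> positive.\<close>
  have "ln (\<sigma> / 2) \<le> \<sigma> / 2 - 1" using \<sigma> by (intro ln_le_minus_one) auto
  then have "ln \<sigma> \<le> \<sigma> / 2" using \<sigma> ln2_le_25_over_36 by (simp add: ln_div)
  then have v3: "\<sigma> \<le> v" using v1 by linarith
  then show "1 \<le> v" using \<sigma> by linarith
  have "ln \<sigma> \<le> ln v" using v3 \<sigma> by simp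
  then have "\<sigma> \<le> v / 2 + ln v" using v1 by linarith
  then have "exp (- v / 2 - ln v) \<le> s" unfolding s_eq by simp
  moreover have "exp (- v / 2 - ln v) = exp (- v / 2) / v" using v3 \<sigma> by (simp add: exp_diff)
  moreover have "s \<le> exp (- v / 2)" unfolding s_eq using v2 by simp
  ultimately show "s \<in> {exp (- v / 2) / v..exp (- v / 2)}" by simp
  \<comment> \<open>The crude bound \<open>v >= \<sigma> > ln (1 / R)\<close> is why the tail begins
    at \<open>\<phi> (1 / R)\<close> instead of \<open>k0 R = \<phi> (1 / R^2)\<close>.\<close>
  have "1 / R = exp (- ln R)" using s by (simp add: exp_minus divide_inverse)
  also have "\<dots> \<le> exp v" using v3 \<sigma> by simp
  also have "\<dots> = \<psi> x" using px by (simp add: v_def)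
  finally show "\<phi> (1 / R) \<le> x" using x1 s by (subst phi_le_iff) auto
qed

text \<open>For fixed \<open>x\<close> the radii \<open>s\<close> with
  \<open>k1 s <= x <= k0 s\<close> lie in an interval of logarithmic length \<open>ln v\<close>,
  where \<open>v = ln (\<psi> x)\<close>. After Tonelli this length is the numerator
  \<open>ln (ln (\<psi> x))\<close>.\<close>

lemma nn_integral_k1_le:
  assumes r: "0 < r" "r < R" and R: "R \<le> exp (-2)"
  shows "(\<integral>\<^sup>+s\<in>{r<..<R}. ennreal (1 / (s * k1 s)) \<partial>lborel) \<le>
    ennreal (J r R) + (\<integral>\<^sup>+x\<in>{\<phi> (1 / R)..}. ennreal (ln (ln (\<psi> x)) / x\<^sup>2) \<partial>lborel)"
proof -
  define D where "D = (\<lambda>s x. ennreal (1 / x\<^sup>2) * indicator {k1 s..k0 s} x)"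
  have kp: "0 < k0 s" "0 < k1 s" for s using k0_ge_1[of s] k1_ge_1[of s] by linarith+
  have D_meas[measurable]: "(\<lambda>(s, x). D s x) \<in> borel_measurable (borel \<Otimes>\<^sub>M borel)"
  proof -
    have "(\<lambda>(s, x). D s x) = (\<lambda>p. ennreal (1 / (snd p)\<^sup>2) * indicator {p. k1 (fst p) \<le> snd p \<and> snd p \<le> k0 (fst p)} p)"
      by (auto simp: D_def split: split_indicator)
    also have "\<dots> \<in> borel_measurable (borel \<Otimes>\<^sub>M borel)" by measurable
    finally show ?thesis .
  qed
  \<comment> \<open>No comparison of \<open>k1\<close> with \<open>k0\<close> is presupposed: if
    \<open>k0 s < k1 s\<close>, then \<open>D s\<close> vanishes and the claim holds by monotonicity
    of the reciprocal.\<close>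
  have diff: "ennreal (1 / k1 s) \<le> ennreal (1 / k0 s) + (\<integral>\<^sup>+x. D s x \<partial>lborel)" for s
  proof (cases "k1 s \<le> k0 s")
    case True
    have "(\<integral>\<^sup>+x. D s x \<partial>lborel) = ennreal (- 1 / k0 s - - 1 / k1 s)"
      unfolding D_def
    proof (rule nn_integral_FTC_Icc)
      fix x assume "x \<in> {k1 s..k0 s}"
      then have "0 < x" using kp[of s] by auto
      then show "((\<lambda>x. - 1 / x) has_real_derivative 1 / x\<^sup>2) (at x)"
        by (auto intro!: derivative_eq_intros simp: power2_eq_square field_simps)
    qed (use True in auto)
    moreover have "1 / k0 s \<le> 1 / k1 s" using True kp[of s] by (intro divide_left_mono) auto
    ultimately show ?thesis using kp[of s] by (simp flip: ennreal_plus)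
  next
    case False
    then have "1 / k1 s \<le> 1 / k0 s" using kp[of s] by (intro divide_left_mono) auto
    then show ?thesis by (intro add_increasing2) (auto intro: ennreal_leI)
  qed
  have "(\<integral>\<^sup>+s\<in>{r<..<R}. ennreal (1 / (s * k1 s)) \<partial>lborel) \<le>
    (\<integral>\<^sup>+s. ennreal (1 / (s * k0 s)) * indicator {r..R} s + ennreal (1 / s) * indicator {r<..<R} s * (\<integral>\<^sup>+x. D s x \<partial>lborel) \<partial>lborel)"
  proof (rule nn_integral_mono)
    fix s
    show "ennreal (1 / (s * k1 s)) * indicator {r<..<R} s \<le>
      ennreal (1 / (s * k0 s)) * indicator {r..R} s + ennreal (1 / s) * indicator {r<..<R} s * (\<integral>\<^sup>+x. D s x \<partial>lborel)"
    proof (cases "s \<in> {r<..<R}")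
      case True
      then have s: "0 < s" using r by auto
      have "ennreal (1 / (s * k1 s)) = ennreal (1 / s) * ennreal (1 / k1 s)"
        using s kp[of s] by (simp flip: ennreal_mult)
      also have "\<dots> \<le> ennreal (1 / s) * (ennreal (1 / k0 s) + (\<integral>\<^sup>+x. D s x \<partial>lborel))"
        by (intro mult_left_mono diff) simp
      also have "\<dots> = ennreal (1 / (s * k0 s)) + ennreal (1 / s) * (\<integral>\<^sup>+x. D s x \<partial>lborel)"
        using s kp[of s] by (simp add: distrib_left flip: ennreal_mult)
      finally show ?thesis using True by simp
    qed simp
  qed
  also have "\<dots> = ennreal (J r R) +
      (\<integral>\<^sup>+s. ennreal (1 / s) * indicator {r<..<R} s * (\<integral>\<^sup>+x. D s x \<partial>lborel) \<partial>lborel)"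
    by (subst nn_integral_add) (simp_all add: nn_integral_J[OF r(1)])
  also have "(\<integral>\<^sup>+s. ennreal (1 / s) * indicator {r<..<R} s * (\<integral>\<^sup>+x. D s x \<partial>lborel) \<partial>lborel) =
      (\<integral>\<^sup>+s. \<integral>\<^sup>+x. ennreal (1 / s) * indicator {r<..<R} s * D s x \<partial>lborel \<partial>lborel)"
    by (intro nn_integral_cong nn_integral_cmult[symmetric]) simp
  also have "\<dots> = (\<integral>\<^sup>+x. \<integral>\<^sup>+s. ennreal (1 / s) * indicator {r<..<R} s * D s x \<partial>lborel \<partial>lborel)"
    by (rule lborel_pair.Fubini'[symmetric]) simp
  also have "ennreal (J r R) + \<dots> \<le> ennreal (J r R) + (\<integral>\<^sup>+x\<in>{\<phi> (1 / R)..}. ennreal (ln (ln (\<psi> x)) / x\<^sup>2) \<partial>lborel)"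
  proof (intro add_left_mono nn_integral_mono)
    fix x
    define v where "v = ln (\<psi> x)"
    show "(\<integral>\<^sup>+s. ennreal (1 / s) * indicator {r<..<R} s * D s x \<partial>lborel) \<le>
        ennreal (ln (ln (\<psi> x)) / x\<^sup>2) * indicator {\<phi> (1 / R)..} x"
    proof (cases "\<phi> (1 / R) \<le> x \<and> 1 \<le> v")
      case True
      let ?a = "exp (- v / 2) / v" and ?b = "exp (- v / 2)"
      have ab: "0 < ?a" "?a \<le> ?b" using True by (auto simp: field_simps)
      have "(\<integral>\<^sup>+s. ennreal (1 / s) * indicator {r<..<R} s * D s x \<partial>lborel) \<le>
          (\<integral>\<^sup>+s. ennreal (1 / x\<^sup>2) * (ennreal (1 / s) * indicator {?a..?b} s) \<partial>lborel)"
      proof (rule nn_integral_mono)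
        fix s
        show "ennreal (1 / s) * indicator {r<..<R} s * D s x \<le> ennreal (1 / x\<^sup>2) * (ennreal (1 / s) * indicator {?a..?b} s)"
          using between_k1_k0(3)[of s R x] r R
          by (auto simp: D_def v_def mult.commute split: split_indicator)
      qed
      also have "\<dots> = ennreal (1 / x\<^sup>2) * (\<integral>\<^sup>+s. ennreal (1 / s) * indicator {?a..?b} s \<partial>lborel)"
        by (rule nn_integral_cmult) simp
      also have "(\<integral>\<^sup>+s. ennreal (1 / s) * indicator {?a..?b} s \<partial>lborel) = ennreal (ln ?b - ln ?a)"
      proof (rule nn_integral_FTC_Icc)
        fix s assume "s \<in> {?a..?b}"
        then have "0 < s" using ab by auto
        then show "(ln has_real_derivative 1 / s) (at s)"
          by (auto intro!: derivative_eq_intros)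
        show "0 \<le> 1 / s" using \<open>0 < s\<close> by simp
      qed (use ab in auto)
      also have "ln ?b - ln ?a = ln v" using True by (simp add: ln_div)
      also have "ennreal (1 / x\<^sup>2) * ennreal (ln v) = ennreal (ln (ln (\<psi> x)) / x\<^sup>2)"
        using True by (simp add: v_def flip: ennreal_mult)
      finally show ?thesis using True by simp
    next
      case False
      have "(\<integral>\<^sup>+s. ennreal (1 / s) * indicator {r<..<R} s * D s x \<partial>lborel) = (\<integral>\<^sup>+s. 0 \<partial>(lborel :: real measure))"
      proof (rule nn_integral_cong)
        fix s
        have "s \<notin> {r<..<R} \<or> x \<notin> {k1 s..k0 s}"
          using between_k1_k0(1,2)[of s R x] r R False unfolding v_def by force
        then show "ennreal (1 / s) * indicator {r<..<R} s * D s x = 0"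
          by (auto simp: D_def)
      qed
      then show ?thesis by simp
    qed
  qed
  finally show ?thesis .
qed

lemma conditional_modulus_ge:
  assumes r: "0 < r" "r < R" and R: "R \<le> exp (-2)" and I: "2 * pi / ln (1 / R) \<le> I" and e: "0 < e"
    and tail: "(\<integral>\<^sup>+x\<in>{\<phi> (1 / R)..}. ennreal (ln (ln (\<psi> x)) / x\<^sup>2) \<partial>lborel) \<le> ennreal e"
  shows "ennreal (2 * pi / (J r R + e)) \<le> conditional_modulus \<psi> I (annulus r R) (joining_curves r R)"
proof -
  have "R < 1" using R by (rule le_less_trans) simp
  have J: "0 < J r R" using J_pos r by simp
  have "ennreal (2 * pi / (J r R + e)) \<le>
      weighted_modulus (\<lambda>z. ennreal (k1 (cmod z)) * indicator (annulus r R) z) (joining_curves r R)"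
  proof (rule weighted_modulus_radial_ge[OF r])
    show "0 < k1 s" for s using k1_ge_1[of s] by linarith
    have "(\<integral>\<^sup>+s\<in>{r<..<R}. ennreal (1 / (s * k1 s)) \<partial>lborel) \<le> ennreal (J r R) + ennreal e"
      using nn_integral_k1_le[OF r R] tail by (meson add_left_mono order.trans)
    then show "(\<integral>\<^sup>+s\<in>{r<..<R}. ennreal (1 / (s * k1 s)) \<partial>lborel) \<le> ennreal (J r R + e)"
      using J e by simp
  qed (use J e in auto)
  also have "\<dots> \<le> conditional_modulus \<psi> I (annulus r R) (joining_curves r R)"
    by (rule weighted_modulus_le_conditional[OF k1_measurable k1_ge_1 k1_feasible[OF r \<open>R < 1\<close> I]])
  finally show ?thesis .
qed

section \<open>The inverse functions and the Stieltjes integral of the statement\<close>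

lemma the_inv_into_ln_psi:
  assumes "0 < R" "R \<le> 1"
  shows "the_inv_into {1<..} (\<lambda>x. ln (\<psi> x)) (2 * ln (1 / R)) = k0 R"
proof (rule the_inv_into_f_eq)
  have pos: "0 < \<psi> x" if "1 < x" for x
    using psi_less_iff[of 1 x] that by (simp add: psi_1)
  \<comment> \<open>The point 1 has to be excluded: by the convention \<open>ln 0 = 0\<close> the
    function takes the value 0 there, as it does at \<open>\<phi> 1\<close>.\<close>
  show "inj_on (\<lambda>x. ln (\<psi> x)) {1<..}"
  proof (rule inj_onI)
    fix x y assume xy: "x \<in> {1<..}" "y \<in> {1<..}" "ln (\<psi> x) = ln (\<psi> y)"
    have "\<psi> x = \<psi> y" using xy(3) pos[of x] pos[of y] xy(1,2) by simp
    then have "\<phi> (\<psi> x) = \<phi> (\<psi> y)" by simp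
    then show "x = y" using xy(1,2) by (simp add: inverse_psi)
  qed
  show "ln (\<psi> (k0 R)) = 2 * ln (1 / R)"
    unfolding psi_k0 using assms(1) by (simp add: ln_div ln_realpow)
  show "k0 R \<in> {1<..}" using k0_gt_1[of R] assms(1) by simp
qed

lemma the_inv_into_psi: "0 \<le> y \<Longrightarrow> the_inv_into {1..} \<psi> y = \<phi> y"
  using strict_mono_on_imp_inj_on[OF strict] inverse_phi[of y] phi_ge_1[of y]
  by (intro the_inv_into_f_eq) auto

text \<open>Three substitutions are chained: \<open>u = ln (\<psi> x)\<close> removes the Stieltjes
  measure, \<open>u = - 2 * w\<close> produces the factor 2 that cancels the \<open>1 / 2\<close>
  and reverses the interval, and \<open>s = exp w\<close> turns \<open>\<phi> (exp u)\<close> into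
  \<open>k0 s\<close>.\<close>

lemma J_eq_stieltjes_integral:
  assumes r: "0 < r" "r < R"
  shows "J r R = 1 / 2 * stieltjes_integral (k0 R) (k0 r) (\<lambda>x. 1 / x) (\<lambda>x. ln (\<psi> x))"
proof -
  let ?F = "\<lambda>x. ln (\<psi> x)" and ?G = "\<lambda>u. \<phi> (exp u)"
  have kp: "0 < k0 s" for s using k0_ge_1[of s] by linarith
  have F0: "?F (k0 s) = - 2 * ln s" if "0 < s" for s
    using that by (simp add: psi_k0 ln_div ln_realpow)
  have pos: "0 < \<psi> x" if "k0 R \<le> x" for x
    using psi_less_iff[of 1 x] k0_gt_1[of R] that r by (simp add: psi_1)
  have ge1: "1 \<le> x" if "k0 R \<le> x" for x using that k0_ge_1[of R] by linarith
  have kle: "k0 R \<le> k0 r" using r by (intro k0_antimono) auto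
  have phi_exp[measurable]: "?G \<in> borel_measurable borel"
    by (intro phi_compose_measurable) auto
  have Gexp: "\<phi> (exp (- 2 * w)) = k0 (exp w)" for w
    by (simp add: k0_def exp_minus exp_double divide_inverse)
  have "stieltjes_integral (k0 R) (k0 r) (\<lambda>x. 1 / x) ?F =
      enn2real (\<integral>\<^sup>+u\<in>{?F (k0 R)..?F (k0 r)}. ennreal (1 / ?G u) \<partial>lborel)"
  proof (rule stieltjes_integral_eq_nn_integral[OF kle])
    show "mono_on {k0 R..k0 r} ?F"
    proof (rule mono_onI)
      fix x y assume "x \<in> {k0 R..k0 r}" "y \<in> {k0 R..k0 r}" "x \<le> y"
      then show "?F x \<le> ?F y" using psi_mono[of x y] pos[of x] pos[of y] ge1[of x] by simp
    qed
    show "continuous_on {k0 R..k0 r} ?F"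
    proof (intro continuous_on_ln ballI)
      show "continuous_on {k0 R..k0 r} \<psi>" by (rule continuous_on_subset[OF psi_cont]) (use ge1 in auto)
      fix x assume "x \<in> {k0 R..k0 r}"
      then show "\<psi> x \<noteq> 0" using pos[of x] by simp
    qed
    show "continuous_on {?F (k0 R)..?F (k0 r)} ?G"
      by (rule continuous_on_compose2[OF phi_cont]) (auto intro!: continuous_intros)
    show "\<phi> (exp (?F x)) = x" if "x \<in> {k0 R..k0 r}" for x
      using that pos[of x] ge1[of x] by (simp add: inverse_psi)
    show "?G u \<in> {k0 R..k0 r} \<and> ?F (?G u) = u" if u: "u \<in> {?F (k0 R)..?F (k0 r)}" for u
    proof -
      have "exp (?F (k0 R)) \<le> exp u" "exp u \<le> exp (?F (k0 r))" using u by auto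
      then have "\<psi> (k0 R) \<le> exp u" "exp u \<le> \<psi> (k0 r)"
        using pos[of "k0 R"] pos[of "k0 r"] kle by simp_all
      then show ?thesis by (simp add: le_phi_iff phi_le_iff k0_ge_1 inverse_phi)
    qed
    show "0 \<le> 1 / x" if "x \<in> {k0 R..k0 r}" for x using ge1[of x] that by auto
  qed simp
  also have "(\<integral>\<^sup>+u\<in>{?F (k0 R)..?F (k0 r)}. ennreal (1 / ?G u) \<partial>lborel) =
      ennreal \<bar>- 2\<bar> * (\<integral>\<^sup>+w. ennreal (1 / ?G (0 + - 2 * w)) * indicator {?F (k0 R)..?F (k0 r)} (0 + - 2 * w) \<partial>lborel)"
    by (rule nn_integral_real_affine) auto
  also have "(\<integral>\<^sup>+w. ennreal (1 / ?G (0 + - 2 * w)) * indicator {?F (k0 R)..?F (k0 r)} (0 + - 2 * w) \<partial>lborel) =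
      (\<integral>\<^sup>+w. ennreal (1 / (exp w * k0 (exp w))) * ennreal (exp w) * indicator {ln r..ln R} w \<partial>lborel)"
  proof (rule nn_integral_cong)
    fix w :: real
    have "ennreal (1 / (exp w * k0 (exp w))) * ennreal (exp w) = ennreal (1 / k0 (exp w))"
      using kp[of "exp w"] by (subst ennreal_mult[symmetric]) auto
    moreover have "indicator {?F (k0 R)..?F (k0 r)} (0 + - 2 * w) = (indicator {ln r..ln R} w :: ennreal)"
      using r by (auto simp: F0 split: split_indicator)
    ultimately show "ennreal (1 / ?G (0 + - 2 * w)) * indicator {?F (k0 R)..?F (k0 r)} (0 + - 2 * w) =
      ennreal (1 / (exp w * k0 (exp w))) * ennreal (exp w) * indicator {ln r..ln R} w"
      by (simp only: Gexp add_0)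
  qed
  also have "\<dots> = (\<integral>\<^sup>+s. ennreal (1 / (s * k0 s)) * indicator {exp (ln r)..exp (ln R)} s \<partial>lborel)"
    by (rule nn_integral_substitution_aux[symmetric])
      (use r in \<open>auto intro!: derivative_eq_intros continuous_intros\<close>)
  also have "\<dots> = ennreal (J r R)"
    using r by (simp add: nn_integral_J)
  finally show ?thesis
    using J_pos[OF r] by (simp add: enn2real_mult)
qed

section \<open>Passage to the limit\<close>

lemma tail_integral_small:
  assumes fin: "(\<integral>\<^sup>+x\<in>{\<phi> (exp 2)..}. ennreal (ln (ln (\<psi> x)) / x\<^sup>2) \<partial>lborel) < \<infinity>" and e: "0 < e"
  shows "\<exists>N. (\<integral>\<^sup>+x\<in>{N..}. ennreal (ln (ln (\<psi> x)) / x\<^sup>2) \<partial>lborel) < ennreal e"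
proof -
  define c where "c = \<phi> (exp 2)"
  have c1: "1 \<le> c" by (simp add: c_def phi_ge_1)
  define f where "f = (\<lambda>n x. ennreal (ln (ln (\<psi> x)) / x\<^sup>2) * indicator {c + real n..} x)"
  have fm: "f n \<in> borel_measurable lborel" for n
  proof -
    note psi_measurable[measurable]
    have "f n = (\<lambda>x. ennreal (ln (ln (\<psi> (max 1 x))) / x\<^sup>2) * indicator {c + real n..} x)"
      using c1 by (auto simp: f_def max_absorb2 split: split_indicator)
    also have "\<dots> \<in> borel_measurable lborel" by measurable
    finally show ?thesis .
  qed
  have "(\<integral>\<^sup>+x. (INF n. f n x) \<partial>lborel) = (INF n. integral\<^sup>N lborel (f n))"
  proof (rule nn_integral_monotone_convergence_INF_decseq[OF _ fm])
    show "decseq f" by (intro decseq_SucI) (auto simp: f_def le_fun_def split: split_indicator)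
    show "integral\<^sup>N lborel (f 0) < \<infinity>" using fin by (simp add: f_def c_def)
  qed
  moreover have "(INF n. f n x) = 0" for x
  proof -
    obtain n where "x - c < real n" using reals_Archimedean2 by blast
    then have "f n x = 0" by (simp add: f_def)
    then have "(INF n. f n x) \<le> 0" by (metis INF_lower UNIV_I)
    then show ?thesis by simp
  qed
  ultimately have "(INF n. integral\<^sup>N lborel (f n)) < ennreal e" using e by simp
  then obtain n where "integral\<^sup>N lborel (f n) < ennreal e" by (auto simp: INF_less_iff)
  then show ?thesis unfolding f_def by blast
qed

end

text \<open>A positive lower bound excludes \<open>M = 0\<close>, and an infinite \<open>M\<close>
  gives \<open>q = 0\<close>. The last conclusion lets several upper bounds \<open>U\<close> be
  applied to one and the same \<open>q\<close>; it is vacuous for infinite \<open>M\<close>.\<close>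

lemma two_pi_inverse_modulus:
  assumes "ennreal (2 * pi / L) \<le> M" "0 < L"
  obtains q where "ereal (2 * pi) * inverse (enn2ereal M) = ereal q" "q \<le> L"
    "\<And>U. 0 < U \<Longrightarrow> M \<le> ennreal U \<Longrightarrow> 2 * pi / U \<le> q"
proof (cases M)
  case (real m)
  have m: "2 * pi / L \<le> m" using assms real by (simp add: ennreal_le_iff)
  have "0 < 2 * pi / L" using assms by simp
  with m have mp: "0 < m" by linarith
  show ?thesis
  proof (rule that[of "2 * pi / m"])
    show "ereal (2 * pi) * inverse (enn2ereal M) = ereal (2 * pi / m)"
      using real mp by (simp add: enn2ereal_ennreal divide_inverse)
    show "2 * pi / m \<le> L" using m mp assms by (simp add: field_simps)
    fix U :: real assume "0 < U" "M \<le> ennreal U"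
    then show "2 * pi / U \<le> 2 * pi / m" using real mp by (intro divide_left_mono) (auto simp: ennreal_le_iff)
  qed
next
  case top
  show ?thesis by (rule that[of 0]) (use top assms in \<open>auto simp: top_unique\<close>)
qed

theorem theorem9:
  fixes \<psi> g :: "real \<Rightarrow> real" and I :: real
  defines "g \<equiv> \<lambda>x. ln (\<psi> x)"
  assumes "strict_mono_on {1..} \<psi>" and "convex_on {1..} \<psi>"
    and "\<exists>\<phi>. homeomorphism {1..} {0..} \<psi> \<phi>"
    and "0 < I"
    and "(\<integral>\<^sup>+x\<in>{the_inv_into {1..} \<psi> (exp 2)..}. ennreal (ln (ln (\<psi> x)) / x\<^sup>2) \<partial>lborel) < \<infinity>"
  shows "\<exists>err :: real \<Rightarrow> real \<Rightarrow> real.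
    (\<forall>r R. 0 < r \<and> r < R \<and> R \<le> 1 \<longrightarrow>
       ereal (2 * pi) * inverse (enn2ereal (conditional_modulus \<psi> I (annulus r R) (joining_curves r R))) =
       ereal (err r R + 1 / 2 *
         stieltjes_integral (the_inv_into {1<..} g (2 * ln (1 / R))) (the_inv_into {1<..} g (2 * ln (1 / r)))
           (\<lambda>x. 1 / x) g)) \<and>
    (\<forall>\<epsilon>>0. \<forall>\<^sub>F R in at_right 0. \<forall>r\<in>{0<..<R}. \<bar>err r R\<bar> < \<epsilon>)"
proof -
  obtain \<phi> where "homeomorphism {1..} {0..} \<psi> \<phi>" using assms(4) by blast
  then interpret modulus_weight \<psi> \<phi>
    using assms(2,3) by unfold_locales
  define M where "M r R = conditional_modulus \<psi> I (annulus r R) (joining_curves r R)" for r R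
  define err where "err r R = real_of_ereal (ereal (2 * pi) * inverse (enn2ereal (M r R))) - J r R" for r R
  have "ereal (2 * pi) * inverse (enn2ereal (M r R)) = ereal (err r R + 1 / 2 *
      stieltjes_integral (the_inv_into {1<..} g (2 * ln (1 / R))) (the_inv_into {1<..} g (2 * ln (1 / r)))
        (\<lambda>x. 1 / x) g)" if r: "0 < r" "r < R" and R: "R \<le> 1" for r R
  proof -
    obtain q where "ereal (2 * pi) * inverse (enn2ereal (M r R)) = ereal q"
      using two_pi_inverse_modulus[OF conditional_modulus_ge_log[OF r, of I, folded M_def]] r by auto
    then show ?thesis
      using r R unfolding g_def
      by (simp add: the_inv_into_ln_psi err_def flip: J_eq_stieltjes_integral[OF r, simplified])
  qed
  moreover have "\<forall>\<^sub>F R in at_right 0. \<forall>r\<in>{0<..<R}. \<bar>err r R\<bar> < \<epsilon>" if \<epsilon>: "0 < \<epsilon>" for \<epsilon>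
  proof -
    have "(\<integral>\<^sup>+x\<in>{\<phi> (exp 2)..}. ennreal (ln (ln (\<psi> x)) / x\<^sup>2) \<partial>lborel) < \<infinity>"
      using assms(6) by (simp add: the_inv_into_psi)
    from tail_integral_small[OF this, of "\<epsilon> / 2"] \<epsilon>
    obtain N where N: "(\<integral>\<^sup>+x\<in>{N..}. ennreal (ln (ln (\<psi> x)) / x\<^sup>2) \<partial>lborel) < ennreal (\<epsilon> / 2)" by auto
    \<comment> \<open>\<open>m\<close> is the size that \<open>\<phi> (1 / R)\<close> and
      \<open>k0 R\<close> must reach: at least 1 to lie in the domain of \<open>\<psi>\<close>, at
      least \<open>N\<close> for the tail, and above \<open>I / (2 * pi * \<epsilon>)\<close> for
      the error term \<open>I / k0 R\<close>.\<close>
    define m where "m = max 1 (max N (I / (2 * pi * \<epsilon>) + 1))"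
    \<comment> \<open>The three bounds serve, in this order, \<open>between_k1_k0\<close>, the
      feasibility of \<open>k1\<close> within the budget \<open>I\<close>, and
      \<open>m <= \<phi> (1 / R)\<close>. The \<open>+ 1\<close> keeps the last denominator
      positive.\<close>
    define R0 where "R0 = min (exp (- 2)) (min (exp (- (2 * pi / I))) (1 / (\<psi> m + 1)))"
    have m: "1 \<le> m" "N \<le> m" "I / (2 * pi * \<epsilon>) < m" by (auto simp: m_def)
    have psim: "0 \<le> \<psi> m" using psi_nonneg m by simp
    have "\<bar>err r R\<bar> < \<epsilon>" if R: "0 < R" "R < R0" and r: "0 < r" "r < R" for r R
    proof -
      have R2: "R \<le> exp (- 2)" and RI: "R \<le> exp (- (2 * pi / I))" and Rm: "R \<le> 1 / (\<psi> m + 1)"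
        using R by (auto simp: R0_def)
      have R1: "R \<le> 1" using R2 by (rule order.trans) simp
      have "\<psi> m + 1 \<le> 1 / R" using Rm psim R by (simp add: field_simps)
      then have "m \<le> \<phi> (1 / R)" using m R by (subst le_phi_iff) auto
      moreover have "1 / R \<le> 1 / R\<^sup>2"
        using R R1 by (intro divide_left_mono) (auto simp: power2_eq_square mult_le_cancel_right1)
      then have "\<phi> (1 / R) \<le> k0 R"
        unfolding k0_def using R by (intro phi_mono) auto
      ultimately have mk: "m \<le> \<phi> (1 / R)" "m \<le> k0 R" by auto
      have "ln R \<le> - (2 * pi / I)"
        using RI R by (metis exp_gt_zero ln_exp ln_le_cancel_iff)
      moreover have "0 < 2 * pi / I" using assms(5) by simp
      moreover have "ln (1 / R) = - ln R" using R by (simp add: ln_div)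
      ultimately have lnR: "0 < ln (1 / R)" "2 * pi / I \<le> ln (1 / R)" by linarith+
      then have I: "2 * pi / ln (1 / R) \<le> I"
        using lnR(2) unfolding pos_divide_le_eq[OF lnR(1)] pos_divide_le_eq[OF assms(5)] by (simp only: mult.commute)
      have "(\<integral>\<^sup>+x\<in>{\<phi> (1 / R)..}. ennreal (ln (ln (\<psi> x)) / x\<^sup>2) \<partial>lborel) \<le>
          (\<integral>\<^sup>+x\<in>{N..}. ennreal (ln (ln (\<psi> x)) / x\<^sup>2) \<partial>lborel)"
        using mk m by (intro nn_integral_mono) (auto split: split_indicator)
      with N have tail: "(\<integral>\<^sup>+x\<in>{\<phi> (1 / R)..}. ennreal (ln (ln (\<psi> x)) / x\<^sup>2) \<partial>lborel) \<le> ennreal (\<epsilon> / 2)"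
        by simp
      have J: "0 < J r R" by (rule J_pos[OF r])
      obtain q where q: "ereal (2 * pi) * inverse (enn2ereal (M r R)) = ereal q" "q \<le> J r R + \<epsilon> / 2"
        and qU: "\<And>U. 0 < U \<Longrightarrow> M r R \<le> ennreal U \<Longrightarrow> 2 * pi / U \<le> q"
        using two_pi_inverse_modulus[OF conditional_modulus_ge[OF r R2 I _ tail, folded M_def]] J \<epsilon>
        by (metis add_pos_pos half_gt_zero)
      define c where "c = I / k0 R"
      have kp: "0 < k0 R" using k0_ge_1[of R] by linarith
      have c: "0 < c" "c < 2 * pi * \<epsilon>"
      proof -
        show "0 < c" using kp assms(5) by (simp add: c_def)
        have "I / (2 * pi * \<epsilon>) < k0 R" using m mk by linarith
        then show "c < 2 * pi * \<epsilon>" using kp \<epsilon> by (simp add: c_def field_simps)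
      qed
      let ?U = "(2 * pi * J r R + c) / (J r R)\<^sup>2"
      have Up: "0 < ?U" using J c by (intro divide_pos_pos add_pos_pos mult_pos_pos) auto
      have "2 * pi / ?U \<le> q"
        using conditional_modulus_le[OF r assms(5), folded M_def c_def] Up by (rule qU[rotated])
      moreover have "J r R - \<epsilon> < 2 * pi / ?U"
      proof -
        \<comment> \<open>The difference of squares yields
          \<open>2 * pi / U >= J - c / (2 * pi)\<close> for the upper bound \<open>U\<close>, an
          absolute error however small or large \<open>J\<close> is; then
          \<open>c < 2 * pi * \<epsilon>\<close> finishes the estimate.\<close>
        have "(2 * pi * J r R - c) * (2 * pi * J r R + c) \<le> (2 * pi * J r R)\<^sup>2"
          by (simp add: algebra_simps power2_eq_square)
        then have "2 * pi * J r R - c \<le> (2 * pi * J r R)\<^sup>2 / (2 * pi * J r R + c)"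
          using J c by (subst pos_le_divide_eq) (auto intro!: add_pos_pos mult_pos_pos)
        also have "\<dots> = 2 * pi * (2 * pi / ?U)"
          by (simp add: power2_eq_square)
        finally have "2 * pi * (J r R - \<epsilon>) < 2 * pi * (2 * pi / ?U)"
          using c by (simp add: right_diff_distrib)
        then show ?thesis by (subst (asm) mult_less_cancel_left_pos) auto
      qed
      moreover have "err r R = q - J r R" by (simp add: err_def q)
      ultimately show ?thesis using q \<epsilon> by (auto simp: abs_less_iff)
    qed
    moreover have "0 < R0" using psim by (simp add: R0_def)
    ultimately show ?thesis
      unfolding eventually_at_right_field by (intro exI[of _ R0]) auto
  qed
  ultimately show ?thesis unfolding M_def by blast
qed

end
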